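(* Let $G=(V,E)$ be any countably infinite, connected, undirected graph of uniformly bounded degree (i.e. there is $\Delta\in\mathbb{N}$ with $\deg(v)\le\Delta$ for all $v\in V$) whose critical parameter for bond percolation satisfies $p_c(G,\text{bond})<1$, and let $u\in(0,1]$. Then $$\beta_c(u)>\beta_c^{\mathrm{per}},$$ where $\beta_c(u)$ is the critical parameter for the occurrence of infinite loops in the random loop model on $G$ with parameter $u$, and $\beta_c^{\mathrm{per}}=-\ln(1-p_c(G,\text{bond}))$.
   Context: Bond percolation: for $p\in[0,1]$ let $\pi_p$ be the product measure on $\{0,1\}^E$ under which each edge is open ($=1$) with probability $p$ and closed ($=0$) with probability $1-p$. $C(v)\subseteq V$ is the set of vertices connected to $v$ by a path of open edges. $p_c=p_c(G,\text{bond})=\inf\{p:\pi_p(|C(v)|=\infty)>0\}$ (independent of $v$ since $G$ is connected), and $\beta_c^{\mathrm{per}}=-\ln(1-p_c)$. Random loop model: let $\beta>0$, $u\in[0,1]$. To each edge $e\in E$ attach the time interval $[0,\beta]$ and, independently over edges, a Poisson point process $X_e$ on $[0,\beta]$ with two kinds of outcomes: "crosses" with intensity $u$ and "double bars" with intensity $1-u$ (independent of each other). Crosses and double bars are called links. The joint law of $X=(X_e)_{e\in E}$ is $\mathbb{P}_{\beta,u}$. Given $X$, the loop through $(x,t)\in V\times[0,\beta]_{\mathrm{per}}$ (where $[0,\beta]_{\mathrm{per}}$ is $[0,\beta]$ with periodic boundary conditions, i.e. $0$ and $\beta$ identified) is the following trajectory: starting at $(x,t)$ move up in time until meeting the first link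 on an edge with endpoint $x$; then jump, at the same time, to the other endpoint of this edge and continue in the same time direction if the link is a cross, in the opposite time direction if it is a double bar; continue by the same rule (always moving in the current time direction until the next link on an edge incident to the current vertex) until the trajectory returns to $(x,t)$. Write $(v,t)\leftrightarrow(w,t')$ for the event that the two space-time points are traversed by the same loop. $L(v)=\{w\in V:(v,0)\leftrightarrow(w,0)\}$ is the set of vertices that the loop starting at $(v,0)$ visits at time $0$. Finally $\beta_c(u)=\inf\{\beta:\mathbb{P}_{\beta,u}(|L(v)|=\infty)>0\}\in[0,\infty]$ (with $\inf\emptyset=\infty$), which does not depend on the choice of $v$. *)

theory Defs
  imports "HOL-Probability.Probability"
begin

section \<open>Graphs\<close>

text \<open>Edges are two-element sets of vertices: undirected, no self-loops, no multiple edges.\<close>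

definition simple_graph :: "'a set \<Rightarrow> 'a set set \<Rightarrow> bool" where
  "simple_graph V E \<longleftrightarrow> E \<subseteq> {{x, y} | x y. x \<in> V \<and> y \<in> V \<and> x \<noteq> y}"

text \<open>Vertices joined to \<open>v\<close> by a finite path with all edges in \<open>F\<close>; this includes \<open>v\<close>.\<close>

definition component :: "'a set set \<Rightarrow> 'a \<Rightarrow> 'a set" where
  "component F v = {w. (v, w) \<in> {(x, y). {x, y} \<in> F}\<^sup>*}"

definition connected_graph :: "'a set \<Rightarrow> 'a set set \<Rightarrow> bool" where
  "connected_graph V E \<longleftrightarrow> (\<forall>v\<in>V. \<forall>w\<in>V. w \<in> component E v)"

definition degree_bounded_by :: "'a set \<Rightarrow> 'a set set \<Rightarrow> nat \<Rightarrow> bool" where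
  "degree_bounded_by V E \<Delta> \<longleftrightarrow>
     (\<forall>v\<in>V. finite {e \<in> E. v \<in> e} \<and> card {e \<in> E. v \<in> e} \<le> \<Delta>)"

section \<open>Bond percolation\<close>

definition percolation_measure :: "'a set set \<Rightarrow> real \<Rightarrow> ('a set \<Rightarrow> bool) measure" where
  "percolation_measure E p = PiM E (\<lambda>_. measure_pmf (bernoulli_pmf p))"

definition cluster :: "'a set set \<Rightarrow> ('a set \<Rightarrow> bool) \<Rightarrow> 'a \<Rightarrow> 'a set" where
  "cluster E \<eta> v = component {e \<in> E. \<eta> e} v"

definition p_c :: "'a set set \<Rightarrow> 'a \<Rightarrow> real" where
  "p_c E v = Inf {p \<in> {0..1}.
     emeasure (percolation_measure E p)
       {\<eta> \<in> space (percolation_measure E p). infinite (cluster E \<eta> v)} > 0}"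

definition beta_c_per :: "'a set set \<Rightarrow> 'a \<Rightarrow> real" where
  "beta_c_per E v = - ln (1 - p_c E v)"

section \<open>Poisson configurations of links\<close>

datatype link_kind = Cross | Double_Bar

text \<open>
  \<^const>\<open>poisson_pmf\<close> is specified for strictly positive parameters only.
\<close>

definition poisson0_pmf :: "real \<Rightarrow> nat pmf" where
  "poisson0_pmf r = (if r = 0 then return_pmf 0 else poisson_pmf r)"

text \<open>
  The homogeneous Poisson point process with intensity \<open>r\<close> on the bounded interval
  \<open>[0, \<beta>]\<close>: a sample \<open>(n, U)\<close> stands for the random set of points \<open>U 0, \<dots>, U (n - 1)\<close>,
  where \<open>n\<close> is Poisson distributed with mean \<open>r * \<beta>\<close> and, independently of \<open>n\<close>, the
  \<open>U i\<close> are independent and uniform on \<open>[0, \<beta>]\<close>.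
\<close>

type_synonym point_sample = "nat \<times> (nat \<Rightarrow> real)"

definition poisson_process :: "real \<Rightarrow> real \<Rightarrow> point_sample measure" where
  "poisson_process r \<beta> =
     measure_pmf (poisson0_pmf (r * \<beta>)) \<Otimes>\<^sub>M
     PiM UNIV (\<lambda>_::nat. uniform_measure lborel {0..\<beta>})"

definition points :: "point_sample \<Rightarrow> real set" where
  "points s = snd s ` {..<fst s}"

fun intensity :: "real \<Rightarrow> link_kind \<Rightarrow> real" where
  "intensity u Cross = u"
| "intensity u Double_Bar = 1 - u"

type_synonym 'a link_config = "'a set \<times> link_kind \<Rightarrow> point_sample"

definition loop_measure :: "'a set set \<Rightarrow> real \<Rightarrow> real \<Rightarrow> 'a link_config measure" where
  "loop_measure E \<beta> u =
     PiM (E \<times> UNIV) (\<lambda>(e, k). poisson_process (intensity u k) \<beta>)"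

section \<open>Loops\<close>

definition link_at :: "'a set set \<Rightarrow> 'a link_config \<Rightarrow> 'a \<Rightarrow> real \<Rightarrow> 'a \<Rightarrow> link_kind \<Rightarrow> bool" where
  "link_at E X x t y k \<longleftrightarrow> {x, y} \<in> E \<and> t \<in> points (X ({x, y}, k))"

definition no_link :: "'a set set \<Rightarrow> 'a link_config \<Rightarrow> 'a \<Rightarrow> real set \<Rightarrow> bool" where
  "no_link E X x T \<longleftrightarrow> (\<forall>t\<in>T. \<forall>y k. \<not> link_at E X x t y k)"

datatype direction = Up | Down

fun opposite :: "direction \<Rightarrow> direction" where
  "opposite Up = Down"
| "opposite Down = Up"

fun turn :: "link_kind \<Rightarrow> direction \<Rightarrow> direction" where
  "turn Cross d = d"
| "turn Double_Bar d = opposite d"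

text \<open>
  Elementary motions of a trajectory in state (vertex, time, current time direction): free
  motion along a time segment without links, motion up to the next link followed by the jump
  across it, and passage through the identified times \<open>0\<close> and \<open>\<beta>\<close>. The starting time of a
  segment is exempt from the link conditions, so that after a jump the trajectory does not
  see again the link it has just used. Coinciding links and links at time \<open>0\<close> or \<open>\<beta>\<close> have
  probability zero.
\<close>

inductive motion ::
  "'a set set \<Rightarrow> real \<Rightarrow> 'a link_config \<Rightarrow> 'a \<times> real \<times> direction \<Rightarrow> 'a \<times> real \<times> direction \<Rightarrow> bool"
  for E \<beta> X where
  move_up: "\<lbrakk>0 \<le> t; t < s; s \<le> \<beta>; no_link E X x {t<..s}\<rbrakk>
    \<Longrightarrow> motion E \<beta> X (x, t, Up) (x, s, Up)"
| move_down: "\<lbrakk>0 \<le> s; s < t; t \<le> \<beta>; no_link E X x {s..<t}\<rbrakk>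
    \<Longrightarrow> motion E \<beta> X (x, t, Down) (x, s, Down)"
| jump_up: "\<lbrakk>0 \<le> t; t < s; s \<le> \<beta>; no_link E X x {t<..<s}; link_at E X x s y k\<rbrakk>
    \<Longrightarrow> motion E \<beta> X (x, t, Up) (y, s, turn k Up)"
| jump_down: "\<lbrakk>0 \<le> s; s < t; t \<le> \<beta>; no_link E X x {s<..<t}; link_at E X x s y k\<rbrakk>
    \<Longrightarrow> motion E \<beta> X (x, t, Down) (y, s, turn k Down)"
| wrap_up: "motion E \<beta> X (x, \<beta>, Up) (x, 0, Up)"
| wrap_down: "motion E \<beta> X (x, 0, Down) (x, \<beta>, Down)"

text \<open>
  All points traversed by the trajectory that starts at a given point in upward direction.
  It is not stopped when it returns to its starting point, since from then on it only
  repeats itself.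
\<close>

definition loop :: "'a set set \<Rightarrow> real \<Rightarrow> 'a link_config \<Rightarrow> 'a \<times> real \<Rightarrow> ('a \<times> real) set" where
  "loop E \<beta> X = (\<lambda>(x, t). {(y, s). \<exists>d. (motion E \<beta> X)\<^sup>*\<^sup>* (x, t, Up) (y, s, d)})"

text \<open>
  For a closed loop the starting point is irrelevant. Quantifying over it makes the relation
  symmetric also for trajectories that never return.
\<close>

definition same_loop ::
  "'a set \<Rightarrow> 'a set set \<Rightarrow> real \<Rightarrow> 'a link_config \<Rightarrow> 'a \<times> real \<Rightarrow> 'a \<times> real \<Rightarrow> bool" where
  "same_loop V E \<beta> X a b \<longleftrightarrow>
     (\<exists>x\<in>V. \<exists>t\<in>{0..\<beta>}. a \<in> loop E \<beta> X (x, t) \<and> b \<in> loop E \<beta> X (x, t))"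

definition loop_vertices ::
  "'a set \<Rightarrow> 'a set set \<Rightarrow> real \<Rightarrow> 'a link_config \<Rightarrow> 'a \<Rightarrow> 'a set" where
  "loop_vertices V E \<beta> X v = {w \<in> V. same_loop V E \<beta> X (v, 0) (w, 0)}"

text \<open>
  The outer measure of an event is its probability if the event is measurable (possibly up to
  null sets); in contrast to \<^const>\<open>emeasure\<close> it does not silently become \<open>0\<close> if it is not.
  The infimum is taken in the extended reals, so that it is \<open>\<infinity>\<close> for the empty set.
\<close>

definition beta_c :: "'a set \<Rightarrow> 'a set set \<Rightarrow> real \<Rightarrow> 'a \<Rightarrow> ereal" where
  "beta_c V E u v = Inf (ereal ` {\<beta>. \<beta> > 0 \<and>
     outer_measure_of (loop_measure E \<beta> u)
       {X \<in> space (loop_measure E \<beta> u). infinite (loop_vertices V E \<beta> X v)} > 0})"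

end

theory Submission
  imports Defs
begin

text \<open>
  Two crosses on the same edge, with no link of an adjacent edge between them in time, undo each
  other: a trajectory that enters the edge at one cross leaves it at the other, back at the vertex
  from which it came. Such an edge carries links but does not help loops to spread. So a loop stays
  inside a cluster of the \<^emph>\<open>effective\<close> edges, those that carry a link and are not blocked in this
  way. The edges that carry a link form bond percolation with parameter \<open>1 - exp (- \<beta>)\<close>, and the
  theorem follows once the effective edges are dominated by bond percolation with a strictly
  smaller parameter that depends continuously on \<open>\<beta>\<close>.

  To get a rule that depends on finitely many data per edge, the time interval is cut into
  finitely many windows and each edge receives a label: no link (\<open>Vacant\<close>), exactly two crosses,
  both in window \<open>i \<ge> 1\<close> and listed in increasing order (\<open>Cross_Pair i\<close>), exactly one cross, in
  window \<open>i\<close> (\<open>Single_Cross i\<close>), or anything else (\<open>Other\<close>). An edge with label \<open>Cross_Pair i\<close> is blocked if no adjacent edge occupies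
  window \<open>i\<close>, where \<open>Other\<close> counts as occupying every window. Lemma
  \<open>loop_vertices_subset_effective\<close> is the deterministic statement about loops.

  The set of effective edges is not compared with percolation directly: that other edges are open
  makes it more likely that an edge carries many links, and this correlation may outweigh the gain.
  Instead the set \<open>A\<close> of edges with a link is fixed first. Given \<open>A\<close>, the labels are independent,
  and conditionally on the status (blocked or not) of all other edges an edge of \<open>A\<close> is blocked with
  probability at least some \<open>\<epsilon> > 0\<close>: whatever the labels are, a modification of boundedly many of them
  near the edge blocks it and leaves the status of every other edge unchanged (\<open>blocked_block_edge\<close>).
  Hence the blocked edges dominate an independent thinning of \<open>A\<close> with rate \<open>\<epsilon>\<close>
  (\<open>bernoulli_domination\<close>), and averaging over \<open>A\<close> bounds the effective edges by percolation with
  parameter \<open>(1 - exp (- \<beta>)) * (1 - \<epsilon>)\<close> (\<open>effective_domination\<close>).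

  All comparisons are made on finite edge sets. An infinite cluster of \<open>v\<close> means that for each \<open>n\<close> the
  cluster leaves the graph ball of radius \<open>n\<close>, an event that depends on finitely many edges
  (\<open>infinite_component_iff\<close>); therefore the probability of an infinite loop is at most the infimum of
  the corresponding percolation probabilities, which is \<open>0\<close> below \<open>p_c\<close>. At \<open>\<beta> = beta_c_per\<close> the
  comparison parameter is strictly below \<open>p_c\<close>, because \<open>p_c > 0\<close> by bounded degree (\<open>p_c_pos\<close>), and
  continuity extends this to a neighbourhood.
\<close>

section \<open>Bernoulli weights on finite sets\<close>

text \<open>
  The expectation of \<open>G\<close> under the random subset of the finite set \<open>S\<close> that contains each element
  independently with probability \<open>p\<close>. A finite sum is easier to manipulate here than an integral.
\<close>

definition bernoulli_sum :: "real \<Rightarrow> 'e set \<Rightarrow> ('e set \<Rightarrow> real) \<Rightarrow> real" where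
  "bernoulli_sum p S G = (\<Sum>T\<in>Pow S. p ^ card T * (1 - p) ^ card (S - T) * G T)"

lemma sum_Pow_insert:
  assumes "finite S" and "e \<notin> S"
  shows "(\<Sum>T\<in>Pow (insert e S). g T) = (\<Sum>T\<in>Pow S. g T + g (insert e T))"
proof -
  have "Pow S \<inter> insert e ` Pow S = {}"
    using assms(2) by auto
  moreover have "inj_on (insert e) (Pow S)"
    using assms(2) by (auto simp: inj_on_def)
  ultimately show ?thesis
    using assms(1)
    by (simp add: Pow_insert sum.union_disjoint sum.reindex sum.distrib)
qed

lemma bernoulli_sum_insert:
  assumes "finite S" and "e \<notin> S"
  shows "bernoulli_sum p (insert e S) G =
    bernoulli_sum p S (\<lambda>T. (1 - p) * G T + p * G (insert e T))"
proof -
  have *: "card (insert e S - T) = Suc (card (S - T))" "card (insert e T) = Suc (card T)"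
    if "T \<in> Pow S" for T
  proof -
    have "finite T" "e \<notin> T" using that assms finite_subset by auto
    moreover have "insert e S - T = insert e (S - T)"
      using that assms by auto
    ultimately show "card (insert e S - T) = Suc (card (S - T))" "card (insert e T) = Suc (card T)"
      using assms by auto
  qed
  show ?thesis
    unfolding bernoulli_sum_def sum_Pow_insert[OF assms]
    by (rule sum.cong) (simp_all add: * assms algebra_simps)
qed

lemma bernoulli_sum_linear:
  "bernoulli_sum p S (\<lambda>T. a * G T + b * H T) = a * bernoulli_sum p S G + b * bernoulli_sum p S H"
  by (simp add: bernoulli_sum_def sum.distrib sum_distrib_left algebra_simps)

lemma bernoulli_sum_scale: "bernoulli_sum p S (\<lambda>T. a * G T) = a * bernoulli_sum p S G"
  by (simp add: bernoulli_sum_def sum_distrib_left algebra_simps)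

lemma bernoulli_sum_cong:
  "(\<And>T. T \<subseteq> S \<Longrightarrow> G T = H T) \<Longrightarrow> bernoulli_sum p S G = bernoulli_sum p S H"
  by (simp add: bernoulli_sum_def)

text \<open>
  Keeping each element of a \<open>p\<close>-random set with probability \<open>r\<close> gives a \<open>p * r\<close>-random set.
\<close>

lemma bernoulli_sum_thinning:
  assumes "finite S"
  shows "bernoulli_sum p S (\<lambda>A. bernoulli_sum r A G) = bernoulli_sum (p * r) S G"
  using assms
proof (induction S arbitrary: G)
  case empty
  show ?case by (simp add: bernoulli_sum_def)
next
  case (insert e S)
  have "bernoulli_sum p (insert e S) (\<lambda>A. bernoulli_sum r A G) =
     bernoulli_sum p S (\<lambda>A. (1 - p) * bernoulli_sum r A G +
       p * bernoulli_sum r A (\<lambda>T. (1 - r) * G T + r * G (insert e T)))"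
    unfolding bernoulli_sum_insert[OF insert.hyps(1,2)]
  proof (rule bernoulli_sum_cong)
    fix A assume "A \<subseteq> S"
    then have "finite A" "e \<notin> A" using insert.hyps finite_subset by auto
    then show "(1 - p) * bernoulli_sum r A G + p * bernoulli_sum r (insert e A) G =
      (1 - p) * bernoulli_sum r A G +
       p * bernoulli_sum r A (\<lambda>T. (1 - r) * G T + r * G (insert e T))"
      by (simp add: bernoulli_sum_insert)
  qed
  also have "\<dots> = (1 - p) * bernoulli_sum (p * r) S G +
       p * bernoulli_sum (p * r) S (\<lambda>T. (1 - r) * G T + r * G (insert e T))"
    by (simp add: bernoulli_sum_linear insert.IH)
  also have "\<dots> = bernoulli_sum (p * r) (insert e S) G"
    unfolding bernoulli_sum_insert[OF insert.hyps(1,2)] bernoulli_sum_linear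
    by (simp add: algebra_simps)
  finally show ?case .
qed

text \<open>
  A random set that contains each element with conditional probability at most \<open>r\<close>, whatever the
  rest of the set is, is dominated by independent sampling with density \<open>r\<close>. The elements are
  resampled independently one after the other; summing out the resampled one preserves the
  hypothesis for the others.
\<close>

lemma bernoulli_domination:
  assumes "finite S"
    and "\<And>e T. e \<in> S \<Longrightarrow> T \<subseteq> S - {e} \<Longrightarrow> (1 - r) * \<mu> (insert e T) \<le> r * \<mu> T"
    and "0 \<le> r" and "r \<le> 1"
    and "\<And>T T'. T \<subseteq> T' \<Longrightarrow> T' \<subseteq> S \<Longrightarrow> G T \<le> G T'"
  shows "(\<Sum>T\<in>Pow S. \<mu> T * G T) \<le> (\<Sum>T\<in>Pow S. \<mu> T) * bernoulli_sum r S G"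
  using assms(1,2,5)
proof (induction S arbitrary: \<mu> G)
  case empty
  show ?case by (simp add: bernoulli_sum_def)
next
  case (insert e S)
  define \<nu> where "\<nu> T = \<mu> T + \<mu> (insert e T)" for T
  define K where "K T = (1 - r) * G T + r * G (insert e T)" for T
  have "(\<Sum>T\<in>Pow (insert e S). \<mu> T * G T) =
      (\<Sum>T\<in>Pow S. \<mu> T * G T + \<mu> (insert e T) * G (insert e T))"
    using sum_Pow_insert[OF insert.hyps(1,2)] .
  also have "\<dots> \<le> (\<Sum>T\<in>Pow S. \<nu> T * K T)"
  proof (rule sum_mono)
    fix T assume T: "T \<in> Pow S"
    \<comment> \<open>Both factors of the product below are nonnegative; expanding it gives the claim.\<close>
    have "G T \<le> G (insert e T)" using T insert.prems(2)[of T "insert e T"] by auto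
    moreover have "(1 - r) * \<mu> (insert e T) \<le> r * \<mu> T"
      using T insert.hyps insert.prems(1)[of e T] by auto
    ultimately have "0 \<le> (G (insert e T) - G T) * (r * \<mu> T - (1 - r) * \<mu> (insert e T))"
      by simp
    then show "\<mu> T * G T + \<mu> (insert e T) * G (insert e T) \<le> \<nu> T * K T"
      by (simp add: \<nu>_def K_def algebra_simps)
  qed
  also have "\<dots> \<le> (\<Sum>T\<in>Pow S. \<nu> T) * bernoulli_sum r S K"
  proof (rule insert.IH)
    fix f T assume "f \<in> S" "T \<subseteq> S - {f}"
    then have "(1 - r) * \<mu> (insert f T) \<le> r * \<mu> T"
      "(1 - r) * \<mu> (insert f (insert e T)) \<le> r * \<mu> (insert e T)"
      using insert.hyps insert.prems(1)[of f T] insert.prems(1)[of f "insert e T"] by auto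
    then show "(1 - r) * \<nu> (insert f T) \<le> r * \<nu> T"
      by (simp add: \<nu>_def algebra_simps insert_commute)
  next
    fix T T' assume "T \<subseteq> T'" "T' \<subseteq> S"
    then have "G T \<le> G T'" "G (insert e T) \<le> G (insert e T')"
      using insert.prems(2)[of T T'] insert.prems(2)[of "insert e T" "insert e T'"] by auto
    then show "K T \<le> K T'"
      using assms(3,4) by (auto simp: K_def intro!: add_mono mult_left_mono)
  qed
  also have "(\<Sum>T\<in>Pow S. \<nu> T) = (\<Sum>T\<in>Pow (insert e S). \<mu> T)"
    unfolding \<nu>_def sum_Pow_insert[OF insert.hyps(1,2)] ..
  also have "bernoulli_sum r S K = bernoulli_sum r (insert e S) G"
    unfolding K_def bernoulli_sum_insert[OF insert.hyps(1,2)] ..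
  finally show ?case .
qed

lemma bernoulli_sum_one: "finite S \<Longrightarrow> bernoulli_sum p S (\<lambda>_. 1) = 1"
  by (induction S rule: finite_induct) (simp_all add: bernoulli_sum_insert, simp add: bernoulli_sum_def)

lemma bernoulli_sum_full: "finite S \<Longrightarrow> bernoulli_sum 1 S G = G S"
  by (induction S arbitrary: G rule: finite_induct)
    (simp_all add: bernoulli_sum_insert, simp add: bernoulli_sum_def)

lemma bernoulli_sum_mono:
  assumes "p \<in> {0..1}" and "\<And>T. T \<subseteq> S \<Longrightarrow> G T \<le> H T"
  shows "bernoulli_sum p S G \<le> bernoulli_sum p S H"
  unfolding bernoulli_sum_def using assms by (intro sum_mono mult_left_mono) auto

lemma bernoulli_sum_sum:
  "bernoulli_sum p S (\<lambda>T. \<Sum>y\<in>Y. G y T) = (\<Sum>y\<in>Y. bernoulli_sum p S (G y))"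
  unfolding bernoulli_sum_def sum_distrib_left by (rule sum.swap)

section \<open>The blocking rule\<close>

text \<open>
  The indices are time windows. Window \<open>0\<close> is reserved for \<open>Single_Cross\<close>: an edge with a single
  cross in window \<open>0\<close> is neither blocked nor an obstacle to the blocking of its neighbours.
\<close>

datatype label = Vacant | Cross_Pair nat | Single_Cross nat | Other

fun occupies :: "label \<Rightarrow> nat \<Rightarrow> bool" where
  "occupies Vacant i = False"
| "occupies (Cross_Pair j) i = (i = j)"
| "occupies (Single_Cross j) i = (i = j)"
| "occupies Other i = True"

definition labels :: "nat \<Rightarrow> label set" where
  "labels m = {Vacant, Other} \<union> Cross_Pair ` {1..m} \<union> Single_Cross ` {0..m}"

lemma finite_labels [simp]: "finite (labels m)"
  by (simp add: labels_def)

definition occupied :: "'e set \<Rightarrow> ('e \<Rightarrow> label) \<Rightarrow> 'e set" where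
  "occupied F x = {e \<in> F. x e \<noteq> Vacant}"

text \<open>
  The relation \<open>adj\<close> and the ambient edge set \<open>F\<close> are parameters, since the rule is used on finite
  edge sets as well as on the whole graph.
\<close>

definition blocked :: "('e \<Rightarrow> 'e \<Rightarrow> bool) \<Rightarrow> 'e set \<Rightarrow> ('e \<Rightarrow> label) \<Rightarrow> 'e set" where
  "blocked adj F x =
    {e \<in> F. \<exists>i. x e = Cross_Pair i \<and> (\<forall>f\<in>F. adj e f \<longrightarrow> \<not> occupies (x f) i)}"

definition effective :: "('e \<Rightarrow> 'e \<Rightarrow> bool) \<Rightarrow> 'e set \<Rightarrow> ('e \<Rightarrow> label) \<Rightarrow> 'e set" where
  "effective adj F x = occupied F x - blocked adj F x"

text \<open>
  The only edges whose labels the modification below may change; their number enters its cost.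
\<close>

definition neighbourhood :: "('e \<Rightarrow> 'e \<Rightarrow> bool) \<Rightarrow> 'e set \<Rightarrow> 'e \<Rightarrow> 'e set" where
  "neighbourhood adj F e = {g \<in> F. g = e \<or> adj e g \<or> (\<exists>f\<in>F. adj e f \<and> adj f g)}"

text \<open>
  The local modification that blocks \<open>e\<close> in window \<open>i\<close>. Unblocked neighbours that carry a link get a
  single cross in window \<open>0\<close>, so that they do not interfere. They might have been the only obstacle
  to the blocking of some \<open>g\<close> at distance two; such a \<open>g\<close> is turned from \<open>Cross_Pair j\<close> into
  \<open>Single_Cross j\<close>, which is never blocked but occupies the same window, so that no further edge
  notices the change. All other vacant and blocked edges keep their labels.
\<close>

definition block_edge ::
  "('e \<Rightarrow> 'e \<Rightarrow> bool) \<Rightarrow> 'e set \<Rightarrow> nat \<Rightarrow> 'e \<Rightarrow> ('e \<Rightarrow> label) \<Rightarrow> 'e \<Rightarrow> label" where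
  "block_edge adj F i e x g =
    (if g = e then Cross_Pair i
     else if g \<notin> neighbourhood adj F e \<or> x g = Vacant \<or> g \<in> blocked adj F x then x g
     else if adj e g then Single_Cross 0
     else case x g of Cross_Pair j \<Rightarrow> Single_Cross j | l \<Rightarrow> l)"

lemma occupied_block_edge:
  assumes "e \<in> occupied F x"
  shows "occupied F (block_edge adj F i e x) = occupied F x"
proof -
  have "block_edge adj F i e x g = Vacant \<longleftrightarrow> x g = Vacant" for g
    using assms by (cases "x g") (auto simp: occupied_def block_edge_def)
  then show ?thesis by (simp add: occupied_def)
qed

lemma block_edge_labels:
  assumes "x \<in> F \<rightarrow>\<^sub>E labels m" and "e \<in> F" and "i \<in> {1..m}"
  shows "block_edge adj F i e x \<in> F \<rightarrow>\<^sub>E labels m"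
proof (rule PiE_I)
  fix g assume "g \<in> F"
  then have "x g \<in> labels m" using assms(1) by auto
  then show "block_edge adj F i e x g \<in> labels m"
    using assms(3) by (auto simp: block_edge_def labels_def)
next
  fix g assume "g \<notin> F"
  then show "block_edge adj F i e x g = undefined"
    using assms(1,2) by (auto simp: block_edge_def neighbourhood_def)
qed

text \<open>
  The index \<open>i\<close> has to be fresh for the neighbours of \<open>e\<close>, because those among them that are blocked
  keep their windows.
\<close>

lemma blocked_block_edge:
  assumes sym: "\<And>f g. adj f g \<Longrightarrow> adj g f"
    and irrefl: "\<not> adj e e"
    and x: "x \<in> F \<rightarrow>\<^sub>E labels m"
    and e: "e \<in> F" and i: "i \<ge> 1"
    and fresh: "\<And>f. f \<in> F \<Longrightarrow> adj e f \<Longrightarrow> x f \<noteq> Cross_Pair i"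
  shows "blocked adj F (block_edge adj F i e x) = insert e (blocked adj F x)"
proof -
  define y where "y = block_edge adj F i e x"
  have pos: "j \<ge> 1" if "x g = Cross_Pair j" "g \<in> F" for g j
    using that x by (force simp: labels_def PiE_iff)
  have y_e: "y e = Cross_Pair i" by (simp add: y_def block_edge_def)
  have keep: "occupies (y h) j \<longleftrightarrow> occupies (x h) j" if "\<not> adj e h" "h \<noteq> e" for h j
    using that by (auto simp: y_def block_edge_def split: label.splits)
  have nbr: "y h = Single_Cross 0 \<or> (y h = x h \<and> (x h = Vacant \<or> h \<in> blocked adj F x))"
    if "adj e h" "h \<in> F" for h
    using that irrefl by (auto simp: y_def block_edge_def neighbourhood_def)
  have e_blocked: "e \<in> blocked adj F y"
  proof -
    \<comment> \<open>Every neighbour of \<open>e\<close> is now vacant, a single cross in window \<open>0\<close>, or blocked in a window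
      other than \<open>i\<close>.\<close>
    have "\<not> occupies (y h) i" if "h \<in> F" "adj e h" for h
      using nbr[OF that(2,1)] fresh[OF that] i by (auto simp: blocked_def)
    then show ?thesis using e y_e by (auto simp: blocked_def)
  qed
  have "g \<in> blocked adj F y \<longleftrightarrow> g \<in> blocked adj F x" if "g \<noteq> e" for g
  proof
    assume g: "g \<in> blocked adj F x"
    then obtain j where j: "x g = Cross_Pair j" "g \<in> F"
      and free: "\<And>h. h \<in> F \<Longrightarrow> adj g h \<Longrightarrow> \<not> occupies (x h) j"
      by (auto simp: blocked_def)
    have "y g = Cross_Pair j"
      using g that j by (simp add: y_def block_edge_def)
    moreover have "\<not> occupies (y h) j" if h: "h \<in> F" "adj g h" for h
    proof (cases "h = e")
      case True
      then show ?thesis using fresh[of g] sym h j y_e by auto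
    next
      case False
      then show ?thesis
        using keep[of h j] nbr[of h] h free[OF h] pos[OF j] by (cases "adj e h") auto
    qed
    ultimately show "g \<in> blocked adj F y" using j by (auto simp: blocked_def)
  next
    assume g: "g \<in> blocked adj F y"
    then obtain j where j: "y g = Cross_Pair j" "g \<in> F"
      and free: "\<And>h. h \<in> F \<Longrightarrow> adj g h \<Longrightarrow> \<not> occupies (y h) j"
      by (auto simp: blocked_def)
    show "g \<in> blocked adj F x"
    proof (rule ccontr)
      assume not: "g \<notin> blocked adj F x"
      \<comment> \<open>An unblocked edge that still has a pair label lies outside the neighbourhood of \<open>e\<close>, and its
        neighbours occupy the same windows as before.\<close>
      have far: "g \<notin> neighbourhood adj F e" and xg: "x g = Cross_Pair j"
        using not that j by (auto simp: y_def block_edge_def split: if_splits label.splits)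
      obtain h where h: "h \<in> F" "adj g h" "occupies (x h) j"
        using not xg j by (auto simp: blocked_def)
      have "\<not> adj e g" "h \<noteq> e" "\<not> adj e h"
        using far h j sym by (auto simp: neighbourhood_def)
      then show False using keep[of h j] h free[of h] by auto
    qed
  qed
  then show ?thesis
    using e_blocked unfolding y_def[symmetric] by (intro set_eqI) (metis insert_iff)
qed

lemma card_neighbourhood:
  assumes "finite F" and "e \<in> F" and deg: "\<And>f. f \<in> F \<Longrightarrow> card {g \<in> F. adj f g} \<le> d"
  shows "card (neighbourhood adj F e) \<le> 1 + d + d * d"
proof -
  have "neighbourhood adj F e \<subseteq>
      {e} \<union> {g \<in> F. adj e g} \<union> (\<Union>f\<in>{f \<in> F. adj e f}. {g \<in> F. adj f g})"
    by (auto simp: neighbourhood_def)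
  then have "card (neighbourhood adj F e) \<le>
      card ({e} \<union> {g \<in> F. adj e g} \<union> (\<Union>f\<in>{f \<in> F. adj e f}. {g \<in> F. adj f g}))"
    using assms(1) by (intro card_mono) auto
  also have "\<dots> \<le> card {e} + card {g \<in> F. adj e g} +
      card (\<Union>f\<in>{f \<in> F. adj e f}. {g \<in> F. adj f g})"
    by (meson add_mono_thms_linordered_semiring(3) card_Un_le le_trans)
  also have "card (\<Union>f\<in>{f \<in> F. adj e f}. {g \<in> F. adj f g}) \<le>
      (\<Sum>f\<in>{f \<in> F. adj e f}. card {g \<in> F. adj f g})"
    using assms(1) by (intro card_UN_le) auto
  also have "\<dots> \<le> (\<Sum>f\<in>{f \<in> F. adj e f}. d)"
    by (intro sum_mono deg) auto
  also have "\<dots> \<le> d * d" using deg[OF assms(2)] by simp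
  finally show ?thesis using deg[OF assms(2)] by simp
qed

section \<open>Stochastic domination by a thinned configuration\<close>

text \<open>
  The factor lost by the modification: each of the at most \<open>1 + d + d * d\<close> changed labels costs a
  factor \<open>1 / a\<close> in probability, where \<open>a\<close> bounds the probability of the new labels from below, and
  a factor \<open>card (labels (d + 1))\<close> for the old labels that are forgotten. With \<open>d\<close> neighbours at most,
  \<open>d + 1\<close> windows suffice to find a fresh one.
\<close>

definition block_cost :: "nat \<Rightarrow> real \<Rightarrow> real" where
  "block_cost d a = (real (card (labels (d + 1))) / a) ^ (1 + d + d * d)"

lemma block_cost_nonneg: "0 < a \<Longrightarrow> 0 \<le> block_cost d a"
  by (simp add: block_cost_def)

text \<open>
  The map \<open>block_edge\<close> sends configurations in which \<open>e\<close> is effective to configurations in which it is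
  blocked and everything else has the same status. It changes boundedly many labels, hence changes
  weights by a bounded factor and is at most boundedly many to one.
\<close>

lemma blocking_ratio:
  assumes F: "finite F" and e: "e \<in> A" and eT: "e \<notin> T"
    and sym: "\<And>f g. adj f g \<Longrightarrow> adj g f" and irrefl: "\<And>f. \<not> adj f f"
    and deg: "\<And>f. f \<in> F \<Longrightarrow> card {g \<in> F. adj f g} \<le> d"
    and q0: "\<And>g l. 0 \<le> q g l" and q1: "\<And>g l. g \<in> F \<Longrightarrow> l \<in> labels (d + 1) \<Longrightarrow> q g l \<le> 1"
    and a0: "0 < a"
    and qPair: "\<And>g i. g \<in> F \<Longrightarrow> i \<in> {1..d+1} \<Longrightarrow> a \<le> q g (Cross_Pair i)"
    and qSingle: "\<And>g i. g \<in> F \<Longrightarrow> i \<in> {0..d+1} \<Longrightarrow> a \<le> q g (Single_Cross i)"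
  defines "\<Omega> \<equiv> F \<rightarrow>\<^sub>E labels (d + 1)"
  shows "(\<Sum>x | x \<in> \<Omega> \<and> occupied F x = A \<and> effective adj F x = insert e T. \<Prod>g\<in>F. q g (x g))
    \<le> block_cost d a *
      (\<Sum>x | x \<in> \<Omega> \<and> occupied F x = A \<and> effective adj F x = T. \<Prod>g\<in>F. q g (x g))"
    (is "sum ?w ?X \<le> _ * sum ?w ?Y")
proof (cases "e \<in> F")
  case False
  then have X: "?X = {}" using e by (auto simp: occupied_def)
  have "0 \<le> block_cost d a" using a0 by (simp add: block_cost_def)
  moreover have "0 \<le> sum ?w ?Y" by (intro sum_nonneg prod_nonneg) (simp add: q0)
  ultimately have "0 \<le> block_cost d a * sum ?w ?Y" by (rule mult_nonneg_nonneg)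
  then show ?thesis unfolding X sum.empty .
next
  case eF: True
  define L where "L = labels (d + 1)"
  define N where "N = 1 + d + d * d"
  define H where "H = neighbourhood adj F e"
  define fresh where "fresh x = (SOME i. i \<in> {1..d+1} \<and> (\<forall>f\<in>F. adj e f \<longrightarrow> x f \<noteq> Cross_Pair i))"
    for x :: "'a \<Rightarrow> label"
  define \<phi> where "\<phi> x = block_edge adj F (fresh x) e x" for x
  have fin\<Omega>: "finite \<Omega>" using F by (auto simp: \<Omega>_def intro!: finite_PiE)
  have a1: "a \<le> 1"
    using qSingle[OF eF, of 0] q1[OF eF, of "Single_Cross 0"] by (auto simp: labels_def)
  have L1: "card L \<ge> 1"
  proof -
    have "Vacant \<in> L" "finite L" by (simp_all add: L_def labels_def)
    then show ?thesis by (metis One_nat_def Suc_leI card_gt_0_iff empty_iff)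
  qed
  have HF: "H \<subseteq> F" by (auto simp: H_def neighbourhood_def)
  have cardH: "card H \<le> N"
    unfolding H_def N_def using card_neighbourhood[OF F eF] deg by blast
  have fresh: "fresh x \<in> {1..d+1} \<and> (\<forall>f\<in>F. adj e f \<longrightarrow> x f \<noteq> Cross_Pair (fresh x))" for x
    unfolding fresh_def
  proof (rule someI_ex, rule ccontr)
    let ?B = "{g \<in> F. adj e g}" and ?idx = "\<lambda>f. case x f of Cross_Pair i \<Rightarrow> i | _ \<Rightarrow> 0"
    \<comment> \<open>Otherwise the at most \<open>d\<close> neighbours of \<open>e\<close> would use all \<open>d + 1\<close> windows.\<close>
    assume "\<nexists>i. i \<in> {1..d+1} \<and> (\<forall>f\<in>F. adj e f \<longrightarrow> x f \<noteq> Cross_Pair i)"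
    then have *: "\<exists>f\<in>F. adj e f \<and> x f = Cross_Pair i" if "i \<in> {1..d+1}" for i using that by auto
    have "i \<in> ?idx ` ?B" if "i \<in> {1..d+1}" for i
      using *[OF that] by force
    then have "card {1..d+1} \<le> card (?idx ` ?B)"
      using F by (intro card_mono) auto
    also have "\<dots> \<le> card ?B" using F by (intro card_image_le) auto
    finally show False using deg[OF eF] by simp
  qed
  have \<phi>_off: "\<phi> x g = x g" if "g \<notin> H" for x g
    using that eF by (auto simp: \<phi>_def block_edge_def H_def neighbourhood_def)
  have \<phi>_on: "\<phi> x g = x g \<or> a \<le> q g (\<phi> x g)" if "x \<in> \<Omega>" "g \<in> F" for x g
  proof -
    have "x g \<in> labels (d + 1)" using that by (auto simp: \<Omega>_def)
    then have "\<phi> x g = x g \<or> (\<exists>i\<in>{1..d+1}. \<phi> x g = Cross_Pair i) \<or> (\<exists>i\<in>{0..d+1}. \<phi> x g = Single_Cross i)"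
      using fresh[of x] unfolding \<phi>_def by (cases "x g") (auto simp: block_edge_def labels_def)
    then show ?thesis using qPair[OF that(2)] qSingle[OF that(2)] by metis
  qed
  have \<phi>_mem: "\<phi> x \<in> ?Y" if "x \<in> ?X" for x
  proof -
    have x: "x \<in> \<Omega>" "occupied F x = A" "effective adj F x = insert e T" using that by auto
    have "\<phi> x \<in> \<Omega>" unfolding \<phi>_def \<Omega>_def
      using fresh[of x] by (intro block_edge_labels x(1)[unfolded \<Omega>_def] eF) blast
    moreover have "occupied F (\<phi> x) = A"
      unfolding \<phi>_def using occupied_block_edge[of e F x adj "fresh x"] e unfolding x(2) by blast
    moreover have "blocked adj F (\<phi> x) = insert e (blocked adj F x)"
      unfolding \<phi>_def using fresh[of x]
      by (intro blocked_block_edge[OF sym irrefl x(1)[unfolded \<Omega>_def] eF]) auto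
    moreover have "A - insert e (blocked adj F x) = T"
      using x(2,3) eT unfolding effective_def by blast
    ultimately show ?thesis by (simp add: effective_def)
  qed
  \<comment> \<open>Passing to the modified labels costs at most a factor \<open>1 / a\<close> per changed edge.\<close>
  have w_le: "?w x \<le> (1 / a) ^ N * ?w (\<phi> x)" if "x \<in> \<Omega>" for x
  proof -
    have "?w x \<le> (\<Prod>g\<in>F. (if g \<in> H then 1 / a else 1) * q g (\<phi> x g))"
    proof (rule prod_mono, intro conjI q0)
      fix g assume g: "g \<in> F"
      have "x g \<in> labels (d + 1)" using that g by (auto simp: \<Omega>_def)
      then have "q g (x g) \<le> 1" by (rule q1[OF g])
      moreover have "1 * q g (\<phi> x g) \<le> 1 / a * q g (\<phi> x g)"
        using a0 a1 by (intro mult_right_mono q0) simp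
      moreover have "1 \<le> 1 / a * q g (\<phi> x g)" if "a \<le> q g (\<phi> x g)"
        using that a0 by (simp add: pos_le_divide_eq)
      ultimately have "q g (x g) \<le> 1 / a * q g (\<phi> x g)"
        using \<phi>_on[OF that g] by (metis mult_1 order_trans)
      then show "q g (x g) \<le> (if g \<in> H then 1 / a else 1) * q g (\<phi> x g)"
        using \<phi>_off[of g x] by simp
    qed
    also have "\<dots> = (1 / a) ^ card H * ?w (\<phi> x)"
    proof -
      have "(\<Prod>g\<in>F. if g \<in> H then 1 / a else 1) = (1 / a) ^ card H"
        using F HF by (simp add: prod.inter_restrict[symmetric] Int_absorb1)
      then show ?thesis by (simp add: prod.distrib)
    qed
    also have "\<dots> \<le> (1 / a) ^ N * ?w (\<phi> x)"
      using cardH a0 a1 q0 by (intro mult_right_mono power_increasing prod_nonneg) auto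
    finally show ?thesis .
  qed
  \<comment> \<open>A configuration is determined by its image and its own labels on \<open>H\<close>.\<close>
  have fibre: "real (card {x \<in> ?X. \<phi> x = y}) \<le> real (card L) ^ N" for y
  proof -
    have "inj_on (\<lambda>x. restrict x H) {x \<in> ?X. \<phi> x = y}"
    proof (rule inj_onI, rule ext)
      fix x x' g
      assume x: "x \<in> {x \<in> ?X. \<phi> x = y}" and x': "x' \<in> {x \<in> ?X. \<phi> x = y}"
        and r: "restrict x H = restrict x' H"
      show "x g = x' g"
      proof (cases "g \<in> H")
        case True
        then show ?thesis using fun_cong[OF r, of g] by simp
      next
        case False
        then show ?thesis using \<phi>_off[of g x] \<phi>_off[of g x'] x x' by auto
      qed
    qed
    moreover have "(\<lambda>x. restrict x H) ` {x \<in> ?X. \<phi> x = y} \<subseteq> H \<rightarrow>\<^sub>E L"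
      using HF by (auto simp: \<Omega>_def L_def)
    moreover have finH: "finite H" using F HF finite_subset by blast
    ultimately have "card {x \<in> ?X. \<phi> x = y} \<le> card (H \<rightarrow>\<^sub>E L)"
      by (intro card_inj_on_le) (auto simp: L_def intro!: finite_PiE)
    also have "\<dots> = card L ^ card H" using finH by (simp add: card_PiE)
    also have "\<dots> \<le> card L ^ N" using L1 cardH by (intro power_increasing)
    finally have "real (card {x \<in> ?X. \<phi> x = y}) \<le> real (card L ^ N)" by (rule of_nat_mono)
    then show ?thesis unfolding of_nat_power .
  qed
  have finX: "finite ?X" "finite ?Y" using fin\<Omega> by auto
  have "sum ?w ?X \<le> (\<Sum>x\<in>?X. (1 / a) ^ N * ?w (\<phi> x))"
    by (intro sum_mono w_le) simp
  also have "\<dots> = (1 / a) ^ N * (\<Sum>x\<in>?X. ?w (\<phi> x))"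
    by (rule sum_distrib_left[symmetric])
  also have "(\<Sum>x\<in>?X. ?w (\<phi> x)) = (\<Sum>y\<in>?Y. \<Sum>x\<in>{x \<in> ?X. \<phi> x = y}. ?w (\<phi> x))"
    by (intro sum.group[symmetric] finX image_subsetI \<phi>_mem)
  also have "\<dots> = (\<Sum>y\<in>?Y. real (card {x \<in> ?X. \<phi> x = y}) * ?w y)"
  proof (rule sum.cong[OF refl])
    fix y
    have "(\<Sum>x\<in>{x \<in> ?X. \<phi> x = y}. ?w (\<phi> x)) = (\<Sum>x\<in>{x \<in> ?X. \<phi> x = y}. ?w y)"
      by (rule sum.cong) auto
    then show "(\<Sum>x\<in>{x \<in> ?X. \<phi> x = y}. ?w (\<phi> x)) = real (card {x \<in> ?X. \<phi> x = y}) * ?w y"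
      by simp
  qed
  also have "(1 / a) ^ N * \<dots> \<le> (1 / a) ^ N * (\<Sum>y\<in>?Y. real (card L) ^ N * ?w y)"
    using a0 q0 by (intro mult_left_mono sum_mono mult_right_mono fibre prod_nonneg) auto
  also have "\<dots> = block_cost d a * sum ?w ?Y"
    by (simp add: block_cost_def sum_distrib_left L_def N_def power_divide power_add power_mult)
  finally show ?thesis .
qed

text \<open>
  The sum on the left is the expectation of \<open>G\<close> of the effective set when the labels are independent
  and edge \<open>g\<close> has label distribution \<open>q g\<close>. The number \<open>C / (1 + C)\<close> is the survival probability
  \<open>1 - \<epsilon>\<close> for which the ratio \<open>C\<close> of \<open>blocking_ratio\<close> is exactly the odds \<open>(1 - \<epsilon>) / \<epsilon>\<close>.
\<close>

lemma effective_domination: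
  assumes F: "finite F"
    and sym: "\<And>f g. adj f g \<Longrightarrow> adj g f" and irrefl: "\<And>f. \<not> adj f f"
    and deg: "\<And>f. f \<in> F \<Longrightarrow> card {g \<in> F. adj f g} \<le> d"
    and q0: "\<And>g l. 0 \<le> q g l" and q_sum: "\<And>g. g \<in> F \<Longrightarrow> sum (q g) (labels (d + 1)) = 1"
    and qVacant: "\<And>g. g \<in> F \<Longrightarrow> q g Vacant = 1 - p"
    and a0: "0 < a"
    and qPair: "\<And>g i. g \<in> F \<Longrightarrow> i \<in> {1..d+1} \<Longrightarrow> a \<le> q g (Cross_Pair i)"
    and qSingle: "\<And>g i. g \<in> F \<Longrightarrow> i \<in> {0..d+1} \<Longrightarrow> a \<le> q g (Single_Cross i)"
    and mono: "\<And>T T'. T \<subseteq> T' \<Longrightarrow> T' \<subseteq> F \<Longrightarrow> G T \<le> G T'"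
  defines "C \<equiv> block_cost d a"
  shows "(\<Sum>x\<in>F \<rightarrow>\<^sub>E labels (d + 1). (\<Prod>g\<in>F. q g (x g)) * G (effective adj F x))
    \<le> bernoulli_sum (p * (C / (1 + C))) F G"
proof -
  define \<Omega> where "\<Omega> = F \<rightarrow>\<^sub>E labels (d + 1)"
  define w where "w x = (\<Prod>g\<in>F. q g (x g))" for x
  define r where "r = C / (1 + C)"
  define \<mu> where "\<mu> A T = (\<Sum>x | x \<in> \<Omega> \<and> occupied F x = A \<and> effective adj F x = T. w x)" for A T
  have C0: "C \<ge> 0" using a0 by (simp add: C_def block_cost_def)
  have r01: "0 \<le> r" "r \<le> 1" "1 - r = 1 / (1 + C)" using C0 by (auto simp: r_def field_simps)
  have q1: "q g l \<le> 1" if "g \<in> F" "l \<in> labels (d + 1)" for g l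
    using member_le_sum[of l "labels (d + 1)" "q g"] that q0 q_sum by simp
  have fin\<Omega>: "finite \<Omega>" using F by (auto simp: \<Omega>_def intro!: finite_PiE)
  have eff: "effective adj F x \<subseteq> occupied F x" "occupied F x \<subseteq> F" for x
    by (auto simp: effective_def occupied_def)
  \<comment> \<open>For fixed \<open>A\<close>, group the label configurations by their effective set.\<close>
  have layer: "(\<Sum>x | x \<in> \<Omega> \<and> occupied F x = A. w x * g (effective adj F x)) =
      (\<Sum>T\<in>Pow A. \<mu> A T * g T)" if A: "A \<subseteq> F" for A and g :: "'a set \<Rightarrow> real"
  proof -
    have "(\<Sum>x | x \<in> \<Omega> \<and> occupied F x = A. w x * g (effective adj F x)) =
      (\<Sum>T\<in>Pow A. \<Sum>x | x \<in> {x. x \<in> \<Omega> \<and> occupied F x = A} \<and> effective adj F x = T.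
          w x * g (effective adj F x))"
      using eff A fin\<Omega> finite_subset[OF A F] by (intro sum.group[symmetric]) auto
    also have "\<dots> = (\<Sum>T\<in>Pow A. \<mu> A T * g T)"
      unfolding \<mu>_def sum_distrib_right by (intro sum.cong) auto
    finally show ?thesis .
  qed
  \<comment> \<open>The occupied set alone is a Bernoulli set of density \<open>p\<close>.\<close>
  have total: "(\<Sum>x | x \<in> \<Omega> \<and> occupied F x = A. w x) = p ^ card A * (1 - p) ^ card (F - A)"
    if A: "A \<subseteq> F" for A
  proof -
    define B where "B g = (if g \<in> A then labels (d + 1) - {Vacant} else {Vacant})" for g
    have E: "Vacant \<in> labels (d + 1)" by (simp add: labels_def)
    have "{x. x \<in> \<Omega> \<and> occupied F x = A} = Pi\<^sub>E F B"
    proof (intro set_eqI iffI)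
      fix x assume "x \<in> {x. x \<in> \<Omega> \<and> occupied F x = A}"
      then show "x \<in> Pi\<^sub>E F B" by (auto simp: \<Omega>_def B_def PiE_iff occupied_def)
    next
      fix x assume x: "x \<in> Pi\<^sub>E F B"
      have *: "(x g = Vacant \<longleftrightarrow> g \<notin> A) \<and> x g \<in> labels (d + 1)" if "g \<in> F" for g
        using PiE_mem[OF x that] E unfolding B_def by (cases "g \<in> A") auto
      have "occupied F x = A" unfolding occupied_def using A * by blast
      then show "x \<in> {x. x \<in> \<Omega> \<and> occupied F x = A}" using x * unfolding \<Omega>_def PiE_iff by blast
    qed
    then have "(\<Sum>x | x \<in> \<Omega> \<and> occupied F x = A. w x) = (\<Prod>g\<in>F. sum (q g) (B g))"
      unfolding w_def using F by (subst prod_sum_PiE) (auto simp: B_def)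
    also have "\<dots> = (\<Prod>g\<in>F. if g \<in> A then p else 1 - p)"
      using E q_sum qVacant by (intro prod.cong) (auto simp: B_def sum_diff1)
    also have "\<dots> = p ^ card (F \<inter> A) * (1 - p) ^ card (F - A)"
      using F by (simp add: prod.If_cases Diff_eq)
    finally show ?thesis using A by (simp add: Int_absorb1)
  qed
  have "(\<Sum>x\<in>\<Omega>. w x * G (effective adj F x)) =
      (\<Sum>A\<in>Pow F. \<Sum>x | x \<in> \<Omega> \<and> occupied F x = A. w x * G (effective adj F x))"
    using F fin\<Omega> eff by (intro sum.group[symmetric]) auto
  also have "\<dots> = (\<Sum>A\<in>Pow F. \<Sum>T\<in>Pow A. \<mu> A T * G T)"
    by (intro sum.cong refl layer) auto
  also have "\<dots> \<le> (\<Sum>A\<in>Pow F. (\<Sum>T\<in>Pow A. \<mu> A T) * bernoulli_sum r A G)"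
  proof (intro sum_mono bernoulli_domination r01)
    fix A assume A: "A \<in> Pow F"
    then show "finite A" using F finite_subset by auto
    show "G T \<le> G T'" if "T \<subseteq> T'" "T' \<subseteq> A" for T T'
      using that A by (intro mono) auto
    fix e T assume e: "e \<in> A" "T \<subseteq> A - {e}"
    then have "\<mu> A (insert e T) \<le> C * \<mu> A T"
      unfolding \<mu>_def C_def w_def \<Omega>_def
      by (intro blocking_ratio[OF F _ _ sym irrefl deg q0 q1 a0 qPair qSingle]) auto
    then show "(1 - r) * \<mu> A (insert e T) \<le> r * \<mu> A T"
      using mult_left_mono[of _ _ "1 / (1 + C)"] C0 unfolding r01(3) by (simp add: r_def)
  qed
  also have "\<dots> = (\<Sum>A\<in>Pow F. (p ^ card A * (1 - p) ^ card (F - A)) * bernoulli_sum r A G)"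
  proof (intro sum.cong refl)
    fix A assume "A \<in> Pow F"
    then show "(\<Sum>T\<in>Pow A. \<mu> A T) * bernoulli_sum r A G =
      (p ^ card A * (1 - p) ^ card (F - A)) * bernoulli_sum r A G"
      using layer[of A "\<lambda>_. 1"] total[of A] by simp
  qed
  also have "\<dots> = bernoulli_sum (p * r) F G"
    using bernoulli_sum_thinning[OF F, of p r G] by (simp add: bernoulli_sum_def)
  finally show ?thesis by (simp add: \<Omega>_def w_def r_def)
qed

section \<open>Finite-dimensional distributions\<close>

text \<open>
  The event is a finite disjoint union over the possible label configurations. Used both for
  percolation, with labels in \<open>bool\<close>, and for the labels of a link configuration.
\<close>

lemma emeasure_finite_labels:
  assumes "finite F" and "finite L"
    and lab: "\<And>\<omega> e. \<omega> \<in> space N \<Longrightarrow> e \<in> F \<Longrightarrow> f e \<omega> \<in> L"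
    and meas: "\<And>x. x \<in> F \<rightarrow>\<^sub>E L \<Longrightarrow> {\<omega> \<in> space N. \<forall>e\<in>F. f e \<omega> = x e} \<in> sets N"
    and law: "\<And>x. x \<in> F \<rightarrow>\<^sub>E L \<Longrightarrow>
      emeasure N {\<omega> \<in> space N. \<forall>e\<in>F. f e \<omega> = x e} = ennreal (\<Prod>e\<in>F. q e (x e))"
    and q0: "\<And>e l. 0 \<le> q e l"
  shows "{\<omega> \<in> space N. Q (\<lambda>e\<in>F. f e \<omega>)} \<in> sets N" (is "?A \<in> _")
    and "emeasure N {\<omega> \<in> space N. Q (\<lambda>e\<in>F. f e \<omega>)} =
      ennreal (\<Sum>x\<in>F \<rightarrow>\<^sub>E L. (\<Prod>e\<in>F. q e (x e)) * of_bool (Q x))"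
proof -
  define \<Omega> where "\<Omega> = F \<rightarrow>\<^sub>E L"
  define B where "B x = {\<omega> \<in> space N. \<forall>e\<in>F. f e \<omega> = x e}" for x
  have fin: "finite \<Omega>" using assms(1,2) by (auto simp: \<Omega>_def intro!: finite_PiE)
  have A: "?A = (\<Union>x\<in>{x \<in> \<Omega>. Q x}. B x)"
  proof (intro set_eqI iffI)
    fix \<omega> assume "\<omega> \<in> ?A"
    then have "(\<lambda>e\<in>F. f e \<omega>) \<in> {x \<in> \<Omega>. Q x}" "\<omega> \<in> B (\<lambda>e\<in>F. f e \<omega>)"
      using lab by (auto simp: \<Omega>_def B_def)
    then show "\<omega> \<in> (\<Union>x\<in>{x \<in> \<Omega>. Q x}. B x)" by blast
  next
    fix \<omega> assume "\<omega> \<in> (\<Union>x\<in>{x \<in> \<Omega>. Q x}. B x)"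
    then obtain x where x: "x \<in> \<Omega>" "Q x" "\<omega> \<in> B x" by blast
    then have "(\<lambda>e\<in>F. f e \<omega>) = x"
      unfolding \<Omega>_def B_def by (intro PiE_ext[where k = F and s = "\<lambda>_. UNIV"]) auto
    then show "\<omega> \<in> ?A" using x by (auto simp: B_def)
  qed
  have B: "B x \<in> sets N" if "x \<in> \<Omega>" for x using that meas by (simp add: \<Omega>_def B_def)
  show "?A \<in> sets N" unfolding A using fin B by (intro sets.finite_UN) auto
  have "disjoint_family_on B {x \<in> \<Omega>. Q x}"
    unfolding disjoint_family_on_def
  proof (intro ballI impI)
    fix x y assume xy: "x \<in> {x \<in> \<Omega>. Q x}" "y \<in> {x \<in> \<Omega>. Q x}" "x \<noteq> y"
    then obtain e where "e \<in> F" "x e \<noteq> y e"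
      unfolding \<Omega>_def by (metis (mono_tags, lifting) PiE_ext mem_Collect_eq)
    then show "B x \<inter> B y = {}" by (auto simp: B_def)
  qed
  then have "emeasure N ?A = (\<Sum>x\<in>{x \<in> \<Omega>. Q x}. emeasure N (B x))"
    unfolding A using fin B by (intro sum_emeasure[symmetric]) auto
  also have "\<dots> = (\<Sum>x\<in>{x \<in> \<Omega>. Q x}. ennreal (\<Prod>e\<in>F. q e (x e)))"
    using law by (intro sum.cong) (auto simp: \<Omega>_def B_def)
  also have "\<dots> = ennreal (\<Sum>x\<in>{x \<in> \<Omega>. Q x}. \<Prod>e\<in>F. q e (x e))"
    by (intro sum_ennreal prod_nonneg q0)
  also have "(\<Sum>x\<in>{x \<in> \<Omega>. Q x}. \<Prod>e\<in>F. q e (x e)) =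
      (\<Sum>x\<in>\<Omega>. (\<Prod>e\<in>F. q e (x e)) * of_bool (Q x))"
    using fin by (intro sum.mono_neutral_cong_left) auto
  finally show "emeasure N ?A = ennreal (\<Sum>x\<in>F \<rightarrow>\<^sub>E L. (\<Prod>e\<in>F. q e (x e)) * of_bool (Q x))"
    unfolding \<Omega>_def .
qed

lemma prob_space_percolation: "prob_space (percolation_measure E p)"
  unfolding percolation_measure_def by (intro prob_space_PiM prob_space_measure_pmf)

lemma bernoulli_sum_eq_PiE:
  assumes "finite F"
  shows "(\<Sum>x\<in>F \<rightarrow>\<^sub>E UNIV. (\<Prod>e\<in>F. if x e then p else 1 - p) * g {e \<in> F. x e}) = bernoulli_sum p F g"
  unfolding bernoulli_sum_def
proof (rule sum.reindex_bij_witness[where i = "\<lambda>T. \<lambda>e\<in>F. e \<in> T" and j = "\<lambda>x. {e \<in> F. x e}"])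
  fix x :: "'a \<Rightarrow> bool" assume x: "x \<in> F \<rightarrow>\<^sub>E UNIV"
  show "(\<lambda>e\<in>F. e \<in> {e \<in> F. x e}) = x"
    using x by (intro ext) (auto simp: PiE_def extensional_def)
  have "(\<Prod>e\<in>F. if x e then p else 1 - p) = p ^ card {e \<in> F. x e} * (1 - p) ^ card {e \<in> F. \<not> x e}"
    using assms by (simp add: prod.If_cases Int_def Collect_neg_eq[symmetric])
  moreover have "{e \<in> F. \<not> x e} = F - {e \<in> F. x e}" by auto
  ultimately show "p ^ card {e \<in> F. x e} * (1 - p) ^ card (F - {e \<in> F. x e}) * g {e \<in> F. x e} =
      (\<Prod>e\<in>F. if x e then p else 1 - p) * g {e \<in> F. x e}" by simp
qed auto

lemma percolation_finite:
  assumes "finite F" and "F \<subseteq> E" and p: "p \<in> {0..1}"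
  defines "N \<equiv> percolation_measure E p"
  shows "{\<eta> \<in> space N. Q {e \<in> F. \<eta> e}} \<in> sets N"
    and "emeasure N {\<eta> \<in> space N. Q {e \<in> F. \<eta> e}} =
      ennreal (bernoulli_sum p F (\<lambda>T. of_bool (Q T)))"
proof -
  let ?M = "\<lambda>_::'a set. measure_pmf (bernoulli_pmf p)"
  let ?q = "\<lambda>(e::'a set) b. if b then p else 1 - p"
  interpret product_prob_space ?M E by unfold_locales
  have meas: "{\<eta> \<in> space N. \<forall>e\<in>F. \<eta> e = x e} \<in> sets N" for x
  proof -
    have "{\<eta> \<in> space N. \<eta> e = x e} \<in> sets N" if "e \<in> F" for e
      using measurable_sets[OF measurable_component_singleton[of e E ?M], of "{x e}"] that assms(2)
      by (auto simp: N_def percolation_measure_def vimage_def Int_def conj_commute)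
    then show ?thesis by (intro sets.sets_Collect_finite_All assms(1))
  qed
  have law: "emeasure N {\<eta> \<in> space N. \<forall>e\<in>F. \<eta> e = x e} = ennreal (\<Prod>e\<in>F. ?q e (x e))" for x
  proof -
    have "emeasure N {\<eta> \<in> space N. \<forall>e\<in>F. \<eta> e \<in> {x e}} =
        (\<Prod>e\<in>F. emeasure (?M e) {x e})"
      unfolding N_def percolation_measure_def using assms(1,2)
      by (intro emeasure_PiM_Collect) auto
    also have "\<dots> = (\<Prod>e\<in>F. ennreal (?q e (x e)))"
      using p by (intro prod.cong) (auto simp: emeasure_pmf_single)
    also have "\<dots> = ennreal (\<Prod>e\<in>F. ?q e (x e))"
      using p by (intro prod_ennreal) auto
    finally show ?thesis by simp
  qed
  have restr: "{e \<in> F. (\<lambda>e\<in>F. \<eta> e) e} = {e \<in> F. \<eta> e}" for \<eta> by auto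
  note * = emeasure_finite_labels[where N = N and F = F and L = UNIV and f = "\<lambda>e \<eta>. \<eta> e"
      and q = ?q and Q = "\<lambda>x. Q {e \<in> F. x e}"]
  have "{\<eta> \<in> space N. Q {e \<in> F. (\<lambda>e\<in>F. \<eta> e) e}} \<in> sets N"
    using p by (intro * assms(1) meas law) auto
  then show "{\<eta> \<in> space N. Q {e \<in> F. \<eta> e}} \<in> sets N" unfolding restr .
  have "emeasure N {\<eta> \<in> space N. Q {e \<in> F. (\<lambda>e\<in>F. \<eta> e) e}} =
    ennreal (\<Sum>x\<in>F \<rightarrow>\<^sub>E UNIV. (\<Prod>e\<in>F. ?q e (x e)) * of_bool (Q {e \<in> F. x e}))"
    using p by (intro * assms(1) meas law) auto
  then show "emeasure N {\<eta> \<in> space N. Q {e \<in> F. \<eta> e}} =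
      ennreal (bernoulli_sum p F (\<lambda>T. of_bool (Q T)))"
    unfolding restr bernoulli_sum_eq_PiE[OF assms(1), of p "\<lambda>T. of_bool (Q T)"] .
qed

section \<open>Exhaustion of the graph and the percolation threshold\<close>

text \<open>
  A walk of \<open>n\<close> steps in \<open>T\<close> from \<open>x\<close> that avoids \<open>U\<close> and never revisits a vertex. The recursion over
  the forbidden set makes its first edge independent of the rest of the walk.
\<close>

fun has_self_avoiding_walk :: "nat \<Rightarrow> 'a \<Rightarrow> 'a set \<Rightarrow> 'a set set \<Rightarrow> bool" where
  "has_self_avoiding_walk 0 x U T = True"
| "has_self_avoiding_walk (Suc n) x U T =
     (\<exists>y. y \<notin> insert x U \<and> {x, y} \<in> T \<and> has_self_avoiding_walk n y (insert x U) T)"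

lemma has_self_avoiding_walk_mono: "has_self_avoiding_walk n x U T \<Longrightarrow> T \<subseteq> T' \<Longrightarrow> has_self_avoiding_walk n x U T'"
  by (induction n arbitrary: x U) auto

text \<open>
  The walk never uses an edge with an endpoint in the forbidden set.
\<close>

lemma has_self_avoiding_walk_insert:
  assumes "e \<inter> U \<noteq> {}" and "x \<notin> U"
  shows "has_self_avoiding_walk n x U (insert e T) = has_self_avoiding_walk n x U T"
  using assms
proof (induction n arbitrary: x U)
  case (Suc n)
  have "has_self_avoiding_walk n y (insert x U) (insert e T) = has_self_avoiding_walk n y (insert x U) T"
    if "y \<notin> insert x U" for y
    using Suc.prems that by (intro Suc.IH) auto
  moreover have "{x, y} \<noteq> e" if "y \<notin> insert x U" for y using Suc.prems that by auto
  ultimately show ?case by auto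
qed simp

text \<open>
  Cut the walk after its last visit to \<open>x\<close>.
\<close>

lemma first_step_avoiding_start:
  assumes "(x, w) \<in> A\<^sup>*" and "w \<noteq> x"
  shows "\<exists>y. (x, y) \<in> A \<and> y \<noteq> x \<and> (y, w) \<in> {(a, b). (a, b) \<in> A \<and> a \<noteq> x \<and> b \<noteq> x}\<^sup>*"
  using assms
proof (induction rule: rtrancl_induct)
  case (step w w')
  show ?case
  proof (cases "w = x")
    case True
    then show ?thesis using step by auto
  next
    case False
    with step obtain y where "(x, y) \<in> A" "y \<noteq> x"
      "(y, w) \<in> {(a, b). (a, b) \<in> A \<and> a \<noteq> x \<and> b \<noteq> x}\<^sup>*" by blast
    moreover have "(w, w') \<in> {(a, b). (a, b) \<in> A \<and> a \<noteq> x \<and> b \<noteq> x}"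
      using step False by simp
    ultimately show ?thesis by (meson rtrancl_into_rtrancl)
  qed
qed simp

text \<open>
  Erasing the returns of a walk to the vertices already visited makes it self-avoiding.
\<close>

lemma short_walk_or_has_self_avoiding_walk:
  assumes "(x, w) \<in> {(a, b). {a, b} \<in> T \<and> a \<notin> U \<and> b \<notin> U}\<^sup>*" and "x \<notin> U"
    and "\<not> has_self_avoiding_walk (Suc n) x U T"
  shows "\<exists>k\<le>n. (x, w) \<in> {(a, b). {a, b} \<in> T} ^^ k"
  using assms
proof (induction n arbitrary: x U)
  case 0
  have "w = x"
  proof (rule ccontr)
    assume "w \<noteq> x"
    from first_step_avoiding_start[OF 0(1) this] 0(3) show False by auto
  qed
  then show ?case by auto
next
  case (Suc n)
  show ?case
  proof (cases "w = x")
    case True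
    then show ?thesis by (intro exI[of _ 0]) auto
  next
    case False
    from first_step_avoiding_start[OF Suc.prems(1) this] obtain y where
      y: "{x, y} \<in> T" "y \<notin> U" "y \<noteq> x" and
      w: "(y, w) \<in> {(a, b). (a, b) \<in> {(a, b). {a, b} \<in> T \<and> a \<notin> U \<and> b \<notin> U} \<and> a \<noteq> x \<and> b \<noteq> x}\<^sup>*"
      by auto
    have "{(a, b). (a, b) \<in> {(a, b). {a, b} \<in> T \<and> a \<notin> U \<and> b \<notin> U} \<and> a \<noteq> x \<and> b \<noteq> x} =
        {(a, b). {a, b} \<in> T \<and> a \<notin> insert x U \<and> b \<notin> insert x U}" by auto
    moreover have "\<not> has_self_avoiding_walk (Suc n) y (insert x U) T"
      using Suc.prems(3) y by (subst (asm) has_self_avoiding_walk.simps(2)) blast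
    ultimately obtain k where "k \<le> n" "(y, w) \<in> {(a, b). {a, b} \<in> T} ^^ k"
      using Suc.IH[of y "insert x U"] w y by auto
    moreover have "(x, y) \<in> {(a, b). {a, b} \<in> T}" using y by simp
    ultimately have "(x, w) \<in> {(a, b). {a, b} \<in> T} ^^ Suc k" by (meson relpow_Suc_I2)
    then show ?thesis using \<open>k \<le> n\<close> by (intro exI[of _ "Suc k"]) auto
  qed
qed

lemma component_mono:
  assumes "T \<subseteq> T'"
  shows "component T v \<subseteq> component T' v"
proof -
  have "{(x, y). {x, y} \<in> T}\<^sup>* \<subseteq> {(x, y). {x, y} \<in> T'}\<^sup>*"
    using assms by (intro rtrancl_mono) auto
  then show ?thesis unfolding component_def by blast
qed

lemma relpow_subset:
  fixes R S :: "('a \<times> 'a) set"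
  assumes "R \<subseteq> S"
  shows "R ^^ k \<subseteq> S ^^ k"
  using assms by (induction k) (simp_all add: relcomp_mono)

definition graph_ball :: "'a set set \<Rightarrow> 'a \<Rightarrow> nat \<Rightarrow> 'a set" where
  "graph_ball E v n = {w. \<exists>k\<le>n. (v, w) \<in> {(x, y). {x, y} \<in> E} ^^ k}"

definition near_edges :: "'a set set \<Rightarrow> 'a \<Rightarrow> nat \<Rightarrow> 'a set set" where
  "near_edges E v n = {e \<in> E. e \<inter> graph_ball E v n \<noteq> {}}"

text \<open>
  For \<open>T \<subseteq> E\<close>, the cluster of \<open>v\<close> in \<open>T\<close> leaves the ball of radius \<open>n\<close>. Intersecting with the finitely
  many edges that touch the ball changes nothing, as a walk that leaves the ball uses only such
  edges up to its first exit, but it makes the dependence on finitely many edges explicit.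
\<close>

definition escapes :: "'a set set \<Rightarrow> 'a \<Rightarrow> nat \<Rightarrow> 'a set set \<Rightarrow> bool" where
  "escapes E v n T \<longleftrightarrow> \<not> component (T \<inter> near_edges E v n) v \<subseteq> graph_ball E v n"

lemma escapes_mono: "escapes E v n T \<Longrightarrow> T \<subseteq> T' \<Longrightarrow> escapes E v n T'"
  unfolding escapes_def using component_mono[of "T \<inter> near_edges E v n" "T' \<inter> near_edges E v n" v]
  by blast

lemma escapes_cong:
  "T \<inter> near_edges E v n = T' \<inter> near_edges E v n \<Longrightarrow> escapes E v n T \<longleftrightarrow> escapes E v n T'"
  by (simp add: escapes_def)

lemma graph_ball_mono: "m \<le> n \<Longrightarrow> graph_ball E v m \<subseteq> graph_ball E v n"
  unfolding graph_ball_def by (auto intro: le_trans)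

lemma graph_ball_Suc: "x \<in> graph_ball E v n \<Longrightarrow> {x, y} \<in> E \<Longrightarrow> y \<in> graph_ball E v (Suc n)"
proof -
  assume "x \<in> graph_ball E v n" "{x, y} \<in> E"
  then obtain k where "k \<le> n" "(v, x) \<in> {(x, y). {x, y} \<in> E} ^^ k" by (auto simp: graph_ball_def)
  moreover have "(x, y) \<in> {(x, y). {x, y} \<in> E}" using \<open>{x, y} \<in> E\<close> by simp
  ultimately have "(v, y) \<in> {(x, y). {x, y} \<in> E} ^^ Suc k" "Suc k \<le> Suc n" by auto
  then show ?thesis unfolding graph_ball_def by blast
qed

lemma component_eq_UN_graph_ball: "component E v = (\<Union>n. graph_ball E v n)"
  by (auto simp: component_def graph_ball_def rtrancl_power)

text \<open>
  A walk that stays in the ball only uses edges that touch it.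
\<close>

lemma component_within_ball:
  assumes "T \<subseteq> E" and "component (T \<inter> near_edges E v n) v \<subseteq> graph_ball E v n"
  shows "component T v \<subseteq> component (T \<inter> near_edges E v n) v"
proof
  fix w assume "w \<in> component T v"
  then have "(v, w) \<in> {(x, y). {x, y} \<in> T}\<^sup>*" by (simp add: component_def)
  then show "w \<in> component (T \<inter> near_edges E v n) v"
  proof (induction rule: rtrancl_induct)
    case base
    show ?case by (simp add: component_def)
  next
    case (step x y)
    then have "{x, y} \<in> T \<inter> near_edges E v n"
      using assms by (auto simp: near_edges_def)
    then have xy: "(x, y) \<in> {(x, y). {x, y} \<in> T \<inter> near_edges E v n}" by simp
    have "(v, x) \<in> {(x, y). {x, y} \<in> T \<inter> near_edges E v n}\<^sup>*"
      using step(3) unfolding component_def by simp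
    from rtrancl_into_rtrancl[OF this xy] show ?case unfolding component_def by simp
  qed
qed

lemma escapes_Suc:
  assumes "T \<subseteq> E" and "escapes E v (Suc n) T"
  shows "escapes E v n T"
proof (rule ccontr)
  assume "\<not> escapes E v n T"
  then have "component T v \<subseteq> graph_ball E v n"
    using component_within_ball[OF assms(1), of v n] unfolding escapes_def by blast
  moreover have "component (T \<inter> near_edges E v (Suc n)) v \<subseteq> component T v"
    by (intro component_mono) simp
  moreover have "graph_ball E v n \<subseteq> graph_ball E v (Suc n)"
    by (intro graph_ball_mono) simp
  ultimately show False using assms(2) unfolding escapes_def by blast
qed

text \<open>
  A vertex outside the ball is not reachable by a walk of at most \<open>n\<close> steps, so a shortest walk to it
  is self-avoiding and has more than \<open>n\<close> steps.
\<close>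

lemma escapes_has_self_avoiding_walk:
  assumes "escapes E v n T"
  shows "has_self_avoiding_walk (Suc n) v {} T"
proof (rule ccontr)
  let ?S = "T \<inter> near_edges E v n"
  assume not: "\<not> has_self_avoiding_walk (Suc n) v {} T"
  then have not': "\<not> has_self_avoiding_walk (Suc n) v {} ?S" using has_self_avoiding_walk_mono[of "Suc n" v "{}" ?S T] by blast
  obtain w where w: "w \<in> component ?S v" "w \<notin> graph_ball E v n"
    using assms by (auto simp: escapes_def)
  then obtain k where "k \<le> n" "(v, w) \<in> {(a, b). {a, b} \<in> ?S} ^^ k"
    using short_walk_or_has_self_avoiding_walk[of v w ?S "{}" n, OF _ _ not'] by (auto simp: component_def)
  moreover have "{(a, b). {a, b} \<in> ?S} ^^ k \<subseteq> {(a, b). {a, b} \<in> E} ^^ k"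
    by (intro relpow_subset) (auto simp: near_edges_def)
  ultimately have "\<exists>k\<le>n. (v, w) \<in> {(a, b). {a, b} \<in> E} ^^ k" by blast
  then show False using w(2) unfolding graph_ball_def by simp
qed

locale bounded_degree_graph =
  fixes V :: "'a set" and E :: "'a set set" and \<Delta> :: nat and v :: 'a
  assumes simple: "simple_graph V E" and degree: "degree_bounded_by V E \<Delta>"
    and infinite_V: "infinite V" and connected: "connected_graph V E" and v: "v \<in> V"
begin

lemma edge_vertices: "{x, y} \<in> E \<Longrightarrow> x \<in> V \<and> y \<in> V \<and> x \<noteq> y"
  using simple by (fastforce simp: simple_graph_def doubleton_eq_iff)

lemma finite_neighbours:
  assumes "x \<in> V"
  shows "finite {y. {x, y} \<in> E}" and "card {y. {x, y} \<in> E} \<le> \<Delta>"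
proof -
  have d: "finite {e \<in> E. x \<in> e}" "card {e \<in> E. x \<in> e} \<le> \<Delta>"
    using degree assms by (auto simp: degree_bounded_by_def)
  have inj: "inj_on (\<lambda>y. {x, y}) {y. {x, y} \<in> E}"
    by (auto simp: inj_on_def doubleton_eq_iff)
  have sub: "(\<lambda>y. {x, y}) ` {y. {x, y} \<in> E} \<subseteq> {e \<in> E. x \<in> e}" by auto
  show "finite {y. {x, y} \<in> E}" using finite_subset[OF sub d(1)] inj finite_imageD by blast
  show "card {y. {x, y} \<in> E} \<le> \<Delta>" using card_inj_on_le[OF inj sub d(1)] d(2) by simp
qed

lemma graph_ball_subset: "graph_ball E v n \<subseteq> V"
proof -
  have "w \<in> V" if "(v, w) \<in> {(x, y). {x, y} \<in> E} ^^ k" for k w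
    using that v edge_vertices by (cases k) auto
  then show ?thesis by (auto simp: graph_ball_def)
qed

lemma finite_graph_ball: "finite (graph_ball E v n)"
proof (induction n)
  case 0
  have "graph_ball E v 0 = {v}" by (auto simp: graph_ball_def)
  then show ?case by simp
next
  case (Suc n)
  have "graph_ball E v (Suc n) \<subseteq> graph_ball E v n \<union> (\<Union>x\<in>graph_ball E v n. {y. {x, y} \<in> E})"
  proof
    fix w assume "w \<in> graph_ball E v (Suc n)"
    then obtain k where k: "k \<le> Suc n" "(v, w) \<in> {(x, y). {x, y} \<in> E} ^^ k"
      by (auto simp: graph_ball_def)
    show "w \<in> graph_ball E v n \<union> (\<Union>x\<in>graph_ball E v n. {y. {x, y} \<in> E})"
    proof (cases k)
      case 0
      then show ?thesis using k by (auto simp: graph_ball_def)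
    next
      case (Suc j)
      then obtain x where "(v, x) \<in> {(x, y). {x, y} \<in> E} ^^ j" "{x, w} \<in> E"
        using k by auto
      then show ?thesis using Suc k by (auto simp: graph_ball_def)
    qed
  qed
  moreover have "finite (\<Union>x\<in>graph_ball E v n. {y. {x, y} \<in> E})"
    using Suc finite_neighbours(1) graph_ball_subset by blast
  ultimately show ?case using Suc by (meson finite_UnI finite_subset)
qed

lemma near_edges_subset: "near_edges E v n \<subseteq> E"
  by (auto simp: near_edges_def)

lemma finite_near_edges: "finite (near_edges E v n)"
proof -
  have "near_edges E v n \<subseteq> (\<Union>x\<in>graph_ball E v n. {e \<in> E. x \<in> e})"
    by (auto simp: near_edges_def)
  moreover have "finite (\<Union>x\<in>graph_ball E v n. {e \<in> E. x \<in> e})"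
  proof (rule finite_UN_I[OF finite_graph_ball])
    fix x assume "x \<in> graph_ball E v n"
    then have "x \<in> V" using graph_ball_subset[of n] by blast
    then show "finite {e \<in> E. x \<in> e}" using degree by (simp add: degree_bounded_by_def)
  qed
  ultimately show ?thesis by (rule finite_subset)
qed

lemma infinite_component_iff:
  assumes "T \<subseteq> E"
  shows "infinite (component T v) \<longleftrightarrow> (\<forall>n. escapes E v n T)"
proof
  assume inf: "infinite (component T v)"
  show "\<forall>n. escapes E v n T"
  proof (rule ccontr)
    assume "\<not> (\<forall>n. escapes E v n T)"
    then obtain n where "component (T \<inter> near_edges E v n) v \<subseteq> graph_ball E v n"
      unfolding escapes_def by blast
    then have "component T v \<subseteq> graph_ball E v n"
      using component_within_ball[OF assms, of v n] by blast
    then show False using inf finite_subset[OF _ finite_graph_ball] by blast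
  qed
next
  assume esc: "\<forall>n. escapes E v n T"
  show "infinite (component T v)"
  proof
    assume fin: "finite (component T v)"
    have "component T v \<subseteq> (\<Union>n. graph_ball E v n)"
      using component_mono[OF assms, of v] unfolding component_eq_UN_graph_ball[of E v] .
    then have "\<forall>w\<in>component T v. \<exists>n. w \<in> graph_ball E v n" by blast
    from bchoice[OF this] obtain h where h: "\<forall>w\<in>component T v. w \<in> graph_ball E v (h w)" ..
    define N where "N = Max (h ` component T v)"
    have "\<forall>w\<in>component T v. h w \<le> N" using fin by (simp add: N_def)
    then have "component T v \<subseteq> graph_ball E v N"
      using h graph_ball_mono[of _ N E v] by blast
    moreover have "component (T \<inter> near_edges E v N) v \<subseteq> component T v"
      by (intro component_mono) auto
    ultimately show False using esc unfolding escapes_def by blast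
  qed
qed

lemma infinite_component_E: "infinite (component E v)"
proof -
  have "V \<subseteq> component E v" using connected v by (auto simp: connected_graph_def)
  then show ?thesis using infinite_V finite_subset by blast
qed

lemma percolation_escape:
  assumes p: "p \<in> {0..1}" and F: "finite F" "near_edges E v n \<subseteq> F" "F \<subseteq> E"
  defines "N \<equiv> percolation_measure E p"
  shows "{\<eta> \<in> space N. escapes E v n {e \<in> E. \<eta> e}} \<in> sets N"
    and "emeasure N {\<eta> \<in> space N. escapes E v n {e \<in> E. \<eta> e}} =
      ennreal (bernoulli_sum p F (\<lambda>T. of_bool (escapes E v n T)))"
proof -
  have "escapes E v n {e \<in> E. \<eta> e} \<longleftrightarrow> escapes E v n {e \<in> F. \<eta> e}" for \<eta>
    using F by (intro escapes_cong) auto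
  then show "{\<eta> \<in> space N. escapes E v n {e \<in> E. \<eta> e}} \<in> sets N"
    "emeasure N {\<eta> \<in> space N. escapes E v n {e \<in> E. \<eta> e}} =
      ennreal (bernoulli_sum p F (\<lambda>T. of_bool (escapes E v n T)))"
    using percolation_finite[OF F(1,3) p, of "escapes E v n"] by (simp_all add: N_def)
qed

text \<open>
  The event of an infinite cluster is the decreasing intersection of the events of escaping from
  the balls, each of which depends on finitely many edges and is therefore measurable.
\<close>

lemma percolation_infinite:
  assumes p: "p \<in> {0..1}"
  defines "N \<equiv> percolation_measure E p"
  shows "emeasure N {\<eta> \<in> space N. infinite (cluster E \<eta> v)} =
    (INF n. emeasure N {\<eta> \<in> space N. escapes E v n {e \<in> E. \<eta> e}})"
proof -
  interpret prob_space N unfolding N_def by (rule prob_space_percolation)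
  let ?A = "\<lambda>n. {\<eta> \<in> space N. escapes E v n {e \<in> E. \<eta> e}}"
  have "{\<eta> \<in> space N. infinite (cluster E \<eta> v)} = (\<Inter>n. ?A n)"
    using infinite_component_iff by (auto simp: cluster_def)
  moreover have "(INF n. emeasure N (?A n)) = emeasure N (\<Inter>n. ?A n)"
  proof (rule INF_emeasure_decseq')
    show "?A n \<in> sets N" for n
      unfolding N_def
      by (rule percolation_escape[OF p finite_near_edges order_refl near_edges_subset])
    show "decseq ?A"
    proof (intro decseq_SucI subsetI)
      fix n \<eta> assume "\<eta> \<in> ?A (Suc n)"
      then show "\<eta> \<in> ?A n" using escapes_Suc[of "{e \<in> E. \<eta> e}" E v n] by simp
    qed
    show "\<exists>i. emeasure N (?A i) \<noteq> \<infinity>" using emeasure_finite by auto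
  qed
  ultimately show ?thesis by simp
qed

text \<open>
  Union bound over the at most \<open>\<Delta>\<close> first edges; the rest of the walk avoids the starting vertex and
  is independent of the first edge.
\<close>

lemma has_self_avoiding_walk_probability:
  assumes p: "p \<in> {0..1}" and "finite S" and "S \<subseteq> E" and "x \<in> V" and "x \<notin> U"
  shows "bernoulli_sum p S (\<lambda>T. of_bool (has_self_avoiding_walk n x U T)) \<le> (real \<Delta> * p) ^ n"
  using assms(2-5)
proof (induction n arbitrary: S x U)
  case 0
  then show ?case by (simp add: bernoulli_sum_one)
next
  case (Suc n)
  define Y where "Y = {y. y \<notin> insert x U \<and> {x, y} \<in> S}"
  define G :: "'a \<Rightarrow> 'a set set \<Rightarrow> real"
    where "G y T = of_bool ({x, y} \<in> T \<and> has_self_avoiding_walk n y (insert x U) T)" for y T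
  have Y_sub: "Y \<subseteq> {y. {x, y} \<in> E}" using Suc.prems by (auto simp: Y_def)
  note nbrs = finite_neighbours[OF Suc.prems(3)]
  have finY: "finite Y" using Y_sub nbrs(1) by (rule finite_subset)
  have cardY: "card Y \<le> \<Delta>" using card_mono[OF nbrs(1) Y_sub] nbrs(2) by (rule le_trans)
  have "bernoulli_sum p S (\<lambda>T. of_bool (has_self_avoiding_walk (Suc n) x U T)) \<le>
      bernoulli_sum p S (\<lambda>T. \<Sum>y\<in>Y. G y T)"
  proof (rule bernoulli_sum_mono[OF p])
    fix T assume T: "T \<subseteq> S"
    show "of_bool (has_self_avoiding_walk (Suc n) x U T) \<le> (\<Sum>y\<in>Y. G y T :: real)"
    proof (cases "has_self_avoiding_walk (Suc n) x U T")
      case True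
      then obtain y where y: "y \<in> Y" "{x, y} \<in> T" "has_self_avoiding_walk n y (insert x U) T"
        using T by (auto simp: Y_def)
      then have "1 = G y T" by (simp add: G_def)
      also have "\<dots> \<le> (\<Sum>y\<in>Y. G y T)"
        using y finY by (intro member_le_sum) (auto simp: G_def)
      finally show ?thesis by simp
    qed (simp add: G_def sum_nonneg del: has_self_avoiding_walk.simps)
  qed
  also have "\<dots> = (\<Sum>y\<in>Y. bernoulli_sum p S (G y))" by (rule bernoulli_sum_sum)
  also have "\<dots> \<le> (\<Sum>y\<in>Y. p * (real \<Delta> * p) ^ n)"
  proof (rule sum_mono)
    fix y assume y: "y \<in> Y"
    define e where "e = {x, y}"
    define R where "R = S - {e}"
    have e: "e \<in> S" "y \<notin> insert x U" "y \<in> V" using y Suc.prems edge_vertices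
      by (auto simp: Y_def e_def)
    have S: "S = insert e R" "e \<notin> R" "finite R" "R \<subseteq> E" using e Suc.prems by (auto simp: R_def)
    have "bernoulli_sum p S (G y) =
        bernoulli_sum p R (\<lambda>T. p * of_bool (has_self_avoiding_walk n y (insert x U) T))"
      unfolding S(1) bernoulli_sum_insert[OF S(3,2)]
    proof (rule bernoulli_sum_cong)
      fix T assume "T \<subseteq> R"
      then have "e \<notin> T" using S by auto
      moreover have "has_self_avoiding_walk n y (insert x U) (insert e T) = has_self_avoiding_walk n y (insert x U) T"
        using e by (intro has_self_avoiding_walk_insert) (auto simp: e_def)
      ultimately show "(1 - p) * G y T + p * G y (insert e T) =
          p * of_bool (has_self_avoiding_walk n y (insert x U) T)"
        by (simp add: G_def e_def)
    qed
    also have "\<dots> = p * bernoulli_sum p R (\<lambda>T. of_bool (has_self_avoiding_walk n y (insert x U) T))"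
      by (rule bernoulli_sum_scale)
    also have "\<dots> \<le> p * (real \<Delta> * p) ^ n"
      using e S p by (intro mult_left_mono Suc.IH) auto
    finally show "bernoulli_sum p S (G y) \<le> p * (real \<Delta> * p) ^ n" .
  qed
  also have "\<dots> = real (card Y) * (p * (real \<Delta> * p) ^ n)" by simp
  also have "\<dots> \<le> real \<Delta> * (p * (real \<Delta> * p) ^ n)"
    using cardY p by (intro mult_right_mono) auto
  finally show ?case by (simp add: mult_ac)
qed

lemma percolation_infinite_small_p:
  assumes p: "p \<in> {0..1}" and "real \<Delta> * p < 1"
  shows "emeasure (percolation_measure E p)
    {\<eta> \<in> space (percolation_measure E p). infinite (cluster E \<eta> v)} = 0"
proof -
  let ?N = "percolation_measure E p"
  let ?\<theta> = "emeasure ?N {\<eta> \<in> space ?N. infinite (cluster E \<eta> v)}"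
  have "?\<theta> \<le> ennreal ((real \<Delta> * p) ^ Suc n)" for n
  proof -
    have "?\<theta> \<le> emeasure ?N {\<eta> \<in> space ?N. escapes E v n {e \<in> E. \<eta> e}}"
      unfolding percolation_infinite[OF p] by (rule INF_lower) simp
    also have "\<dots> = ennreal (bernoulli_sum p (near_edges E v n) (\<lambda>T. of_bool (escapes E v n T)))"
      by (rule percolation_escape[OF p finite_near_edges order_refl near_edges_subset])
    also have "\<dots> \<le> ennreal (bernoulli_sum p (near_edges E v n) (\<lambda>T. of_bool (has_self_avoiding_walk (Suc n) v {} T)))"
      using escapes_has_self_avoiding_walk by (intro ennreal_leI bernoulli_sum_mono[OF p]) (auto simp del: has_self_avoiding_walk.simps)
    also have "\<dots> \<le> ennreal ((real \<Delta> * p) ^ Suc n)"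
      using v by (intro ennreal_leI has_self_avoiding_walk_probability[OF p finite_near_edges near_edges_subset]) auto
    finally show ?thesis .
  qed
  moreover have "(\<lambda>n. ennreal ((real \<Delta> * p) ^ Suc n)) \<longlonglongrightarrow> ennreal 0"
    using assms by (intro tendsto_ennrealI LIMSEQ_Suc LIMSEQ_power_zero) auto
  ultimately have "?\<theta> \<le> ennreal 0" by (intro LIMSEQ_le_const[of _ "ennreal 0"]) blast+
  then show ?thesis by simp
qed

lemma percolation_infinite_at_1:
  "emeasure (percolation_measure E 1)
    {\<eta> \<in> space (percolation_measure E 1). infinite (cluster E \<eta> v)} = 1"
proof -
  have "escapes E v n (near_edges E v n)" for n
  proof -
    have "E \<inter> near_edges E v n = near_edges E v n \<inter> near_edges E v n"
      using near_edges_subset[of n] by blast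
    moreover have "escapes E v n E"
      using infinite_component_iff[OF order_refl] infinite_component_E by simp
    ultimately show ?thesis using escapes_cong[of E E v n "near_edges E v n"] by simp
  qed
  then have "emeasure (percolation_measure E 1)
      {\<eta> \<in> space (percolation_measure E 1). escapes E v n {e \<in> E. \<eta> e}} = 1" for n
    using percolation_escape(2)[of 1 "near_edges E v n" n]
    by (simp add: finite_near_edges near_edges_subset bernoulli_sum_full)
  then show ?thesis using percolation_infinite[of 1] by simp
qed

text \<open>
  Self-avoiding walks of length \<open>n\<close> are open with total probability at most \<open>(\<Delta> * p) ^ n\<close>, so there is
  no infinite cluster for \<open>\<Delta> * p < 1\<close>. The set whose infimum is taken has to be seen to be nonempty,
  because \<open>Inf {}\<close> is unspecified in the reals; it contains \<open>1\<close>.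
\<close>

lemma p_c_pos: "0 < p_c E v"
proof -
  have "1 / (real \<Delta> + 1) \<le> p_c E v"
    unfolding p_c_def
  proof (rule cInf_greatest)
    have "1 \<in> {p \<in> {0..1}. emeasure (percolation_measure E p)
        {\<eta> \<in> space (percolation_measure E p). infinite (cluster E \<eta> v)} > 0}"
      using percolation_infinite_at_1 by simp
    then show "{p \<in> {0..1}. emeasure (percolation_measure E p)
        {\<eta> \<in> space (percolation_measure E p). infinite (cluster E \<eta> v)} > 0} \<noteq> {}"
      by blast
    fix p assume "p \<in> {p \<in> {0..1}. emeasure (percolation_measure E p)
        {\<eta> \<in> space (percolation_measure E p). infinite (cluster E \<eta> v)} > 0}"
    then have "p \<in> {0..1}" "\<not> real \<Delta> * p < 1" using percolation_infinite_small_p[of p] by auto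
    then show "1 / (real \<Delta> + 1) \<le> p"
      by (auto simp: field_simps)
  qed
  moreover have "0 < 1 / (real \<Delta> + 1)" by simp
  ultimately show ?thesis by linarith
qed

lemma subcritical:
  assumes "p \<in> {0..1}" and "p < p_c E v"
  shows "(INF n. emeasure (percolation_measure E p)
    {\<eta> \<in> space (percolation_measure E p). escapes E v n {e \<in> E. \<eta> e}}) = 0"
proof (rule ccontr)
  assume "\<not> ?thesis"
  then have "p \<in> {p \<in> {0..1}. emeasure (percolation_measure E p)
      {\<eta> \<in> space (percolation_measure E p). infinite (cluster E \<eta> v)} > 0}"
    using assms(1) percolation_infinite[OF assms(1)] by (simp add: zero_less_iff_neq_zero)
  then have "p_c E v \<le> p"
    unfolding p_c_def by (rule cInf_lower) (auto intro!: bdd_belowI[of _ 0])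
  then show False using assms(2) by simp
qed

end

section \<open>Loops do not cross blocked edges\<close>

text \<open>
  \<open>D\<close> is a set of edges whose only links are two crosses, at times \<open>s\<^sub>1 e\<close> and \<open>s\<^sub>2 e\<close>, such that no
  adjacent edge has a link between these times.
\<close>

locale blocked_links =
  fixes E :: "'a set set" and \<beta> :: real and X :: "'a link_config"
    and D :: "'a set set" and s\<^sub>1 s\<^sub>2 :: "'a set \<Rightarrow> real"
  assumes D_sub: "D \<subseteq> E"
    and order: "e \<in> D \<Longrightarrow> 0 < s\<^sub>1 e \<and> s\<^sub>1 e < s\<^sub>2 e \<and> s\<^sub>2 e < \<beta>"
    and crosses: "e \<in> D \<Longrightarrow> points (X (e, Cross)) = {s\<^sub>1 e, s\<^sub>2 e}"
    and bars: "e \<in> D \<Longrightarrow> points (X (e, Double_Bar)) = {}"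
    and isolated: "\<lbrakk>e \<in> D; f \<in> E; f \<noteq> e; f \<inter> e \<noteq> {}; t \<in> points (X (f, k))\<rbrakk>
      \<Longrightarrow> t \<notin> {s\<^sub>1 e..s\<^sub>2 e}"
begin

text \<open>
  A trajectory at time \<open>t\<close> and moving in direction \<open>d\<close> at an endpoint of \<open>e\<close> is between the two
  crosses of \<open>e\<close>. The closed end of the interval is the cross that has just been used.
\<close>

definition inside :: "'a set \<Rightarrow> real \<Rightarrow> direction \<Rightarrow> bool" where
  "inside e t d \<longleftrightarrow> (case d of Up \<Rightarrow> s\<^sub>1 e \<le> t \<and> t < s\<^sub>2 e | Down \<Rightarrow> s\<^sub>1 e < t \<and> t \<le> s\<^sub>2 e)"

text \<open>
  The vertex to which the current position is attributed: during an excursion over a blocked edge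
  \<open>{x, b}\<close> the trajectory sits at \<open>x\<close>, but the next link takes it back to \<open>b\<close>.
\<close>

definition base_of :: "'a \<times> real \<times> direction \<Rightarrow> 'a \<Rightarrow> bool" where
  "base_of = (\<lambda>(x, t, d) b. ({x, b} \<in> D \<and> inside {x, b} t d) \<or>
     (b = x \<and> (\<forall>y. {x, y} \<in> D \<longrightarrow> \<not> inside {x, y} t d)))"

definition linked :: "'a set set" where
  "linked = {e \<in> E. \<exists>k. points (X (e, k)) \<noteq> {}} - D"

lemma base_exists: "\<exists>b. base_of \<sigma> b"
  by (cases \<sigma>) (auto simp: base_of_def)

lemma inside_interval: "inside e t d \<Longrightarrow> t \<in> {s\<^sub>1 e..s\<^sub>2 e}"
  by (cases d) (auto simp: inside_def)

lemma not_inside_at_link: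
  assumes "e \<in> D" and "link_at E X x t y k" and "e \<noteq> {x, y}" and "x \<in> e \<or> y \<in> e"
  shows "\<not> inside e t d"
  using isolated[of e "{x, y}" t k] assms inside_interval[of e t d] by (auto simp: link_at_def)

lemma inside_unique:
  assumes "{x, y} \<in> D" and "{x, z} \<in> D" and "inside {x, y} t d" and "inside {x, z} t d"
  shows "y = z"
proof (rule ccontr)
  assume "y \<noteq> z"
  then have ne: "{x, y} \<noteq> {x, z}" by (simp add: doubleton_eq_iff)
  have "s\<^sub>1 {x, y} \<notin> {s\<^sub>1 {x, z}..s\<^sub>2 {x, z}}"
    using isolated[of "{x, z}" "{x, y}" "s\<^sub>1 {x, y}" Cross] assms ne D_sub crosses by auto
  moreover have "s\<^sub>1 {x, z} \<notin> {s\<^sub>1 {x, y}..s\<^sub>2 {x, y}}"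
    using isolated[of "{x, y}" "{x, z}" "s\<^sub>1 {x, z}" Cross] assms ne D_sub crosses by auto
  ultimately show False
    using inside_interval[OF assms(3)] inside_interval[OF assms(4)] by auto
qed

lemma link_at_blocked:
  assumes "{x, y} \<in> D"
  shows "link_at E X x t y k \<longleftrightarrow> k = Cross \<and> t \<in> {s\<^sub>1 {x, y}, s\<^sub>2 {x, y}}"
  using assms D_sub crosses[OF assms] bars[OF assms] by (cases k) (auto simp: link_at_def)

lemma no_link_blocked:
  assumes "{x, y} \<in> D" and "no_link E X x T"
  shows "s\<^sub>1 {x, y} \<notin> T" and "s\<^sub>2 {x, y} \<notin> T"
  using assms(2) link_at_blocked[OF assms(1)] unfolding no_link_def by blast+

lemma base_of_non_inside:
  assumes "base_of (x, t, d) b" and "\<And>y. {x, y} \<in> D \<Longrightarrow> \<not> inside {x, y} t d"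
  shows "b = x"
  using assms by (auto simp: base_of_def)

lemma base_ofI:
  assumes "\<And>y. {x, y} \<in> D \<Longrightarrow> \<not> inside {x, y} t d"
  shows "base_of (x, t, d) x"
  using assms by (auto simp: base_of_def)

text \<open>
  Blocked edges never change the base: the first cross met on such an edge starts an excursion, the
  second one ends it, and in between no other link is met. All other jumps use linked edges and
  start and end outside excursions.
\<close>

lemma motion_base:
  assumes "motion E \<beta> X \<sigma> \<sigma>'" and "base_of \<sigma> b"
  shows "\<exists>b'. base_of \<sigma>' b' \<and> (b' = b \<or> {b, b'} \<in> linked)"
  using assms
proof (induction rule: motion.cases)
  case (move_up t s x)
  have "inside {x, y} t Up \<longleftrightarrow> inside {x, y} s Up" if "{x, y} \<in> D" for y
    using no_link_blocked[OF that move_up(6)] move_up(4) by (auto simp: inside_def)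
  then have "base_of (x, s, Up) b" using move_up(1,7) by (auto simp: base_of_def)
  then show ?case using move_up(2) by auto
next
  case (move_down s t x)
  have "inside {x, y} t Down \<longleftrightarrow> inside {x, y} s Down" if "{x, y} \<in> D" for y
    using no_link_blocked[OF that move_down(6)] move_down(4) by (auto simp: inside_def)
  then have "base_of (x, s, Down) b" using move_down(1,7) by (auto simp: base_of_def)
  then show ?case using move_down(2) by auto
next
  case (jump_up t s x y k)
  have B: "base_of (x, t, Up) b" using jump_up(1,8) by simp
  \<comment> \<open>No excursion over an edge other than \<open>{x, y}\<close> is under way, neither before nor after the jump.\<close>
  have other: "\<not> inside {x, z} t Up" if "{x, z} \<in> D" "z \<noteq> y" for z
  proof
    assume i: "inside {x, z} t Up"
    have "s \<notin> {s\<^sub>1 {x, z}..s\<^sub>2 {x, z}}"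
      using isolated[of "{x, z}" "{x, y}" s k] that jump_up(7)
      by (auto simp: link_at_def doubleton_eq_iff)
    moreover have "s\<^sub>2 {x, z} \<notin> {t<..<s}" using no_link_blocked[OF that(1) jump_up(6)] by simp
    ultimately show False using i jump_up(4) by (auto simp: inside_def)
  qed
  have after: "\<not> inside {y, z} s d" if "{y, z} \<in> D" "z \<noteq> x" for z d
    using not_inside_at_link[OF that(1) jump_up(7)] that(2) by (auto simp: doubleton_eq_iff)
  show ?case
  proof (cases "{x, y} \<in> D")
    case True
    then have k: "k = Cross" and s: "s = s\<^sub>1 {x, y} \<or> s = s\<^sub>2 {x, y}"
      using jump_up(7) link_at_blocked by auto
    note ord = order[OF True]
    from s show ?thesis
    proof
      assume s1: "s = s\<^sub>1 {x, y}"
      have "\<not> inside {x, y} t Up" using s1 jump_up(4) by (simp add: inside_def)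
      then have "b = x" using other by (intro base_of_non_inside[OF B]) blast
      moreover have "base_of (y, s, Up) x"
        using True s1 ord by (simp add: base_of_def inside_def insert_commute)
      ultimately show ?thesis using jump_up(2) k by auto
    next
      assume s2: "s = s\<^sub>2 {x, y}"
      have "s\<^sub>1 {x, y} \<le> t"
        using no_link_blocked(1)[OF True jump_up(6)] s2 ord by auto
      then have i: "inside {x, y} t Up" using s2 jump_up(4) by (simp add: inside_def)
      then have "b = y"
        using B True i inside_unique[OF True _ i] unfolding base_of_def by blast
      moreover have "\<not> inside {y, x} s Up"
        using s2 by (simp add: inside_def insert_commute)
      then have "base_of (y, s, Up) y" using after by (intro base_ofI) blast
      ultimately show ?thesis using jump_up(2) k by auto
    qed
  next
    case False
    then have "b = x" using other by (intro base_of_non_inside[OF B]) blast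
    moreover have "base_of (y, s, turn k Up) y"
      using after False by (intro base_ofI) (auto simp: insert_commute)
    moreover have "{x, y} \<in> linked"
      using False jump_up(7) by (auto simp: linked_def link_at_def)
    ultimately show ?thesis using jump_up(2) by auto
  qed
next
  case (jump_down s t x y k)
  have B: "base_of (x, t, Down) b" using jump_down(1,8) by simp
  have other: "\<not> inside {x, z} t Down" if "{x, z} \<in> D" "z \<noteq> y" for z
  proof
    assume i: "inside {x, z} t Down"
    have "s \<notin> {s\<^sub>1 {x, z}..s\<^sub>2 {x, z}}"
      using isolated[of "{x, z}" "{x, y}" s k] that jump_down(7)
      by (auto simp: link_at_def doubleton_eq_iff)
    moreover have "s\<^sub>1 {x, z} \<notin> {s<..<t}" using no_link_blocked[OF that(1) jump_down(6)] by simp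
    ultimately show False using i jump_down(4) by (auto simp: inside_def)
  qed
  have after: "\<not> inside {y, z} s d" if "{y, z} \<in> D" "z \<noteq> x" for z d
    using not_inside_at_link[OF that(1) jump_down(7)] that(2) by (auto simp: doubleton_eq_iff)
  show ?case
  proof (cases "{x, y} \<in> D")
    case True
    then have k: "k = Cross" and s: "s = s\<^sub>2 {x, y} \<or> s = s\<^sub>1 {x, y}"
      using jump_down(7) link_at_blocked by auto
    note ord = order[OF True]
    from s show ?thesis
    proof
      assume s2: "s = s\<^sub>2 {x, y}"
      have "\<not> inside {x, y} t Down" using s2 jump_down(4) by (simp add: inside_def)
      then have "b = x" using other by (intro base_of_non_inside[OF B]) blast
      moreover have "base_of (y, s, Down) x"
        using True s2 ord by (simp add: base_of_def inside_def insert_commute)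
      ultimately show ?thesis using jump_down(2) k by auto
    next
      assume s1: "s = s\<^sub>1 {x, y}"
      have "t \<le> s\<^sub>2 {x, y}"
        using no_link_blocked(2)[OF True jump_down(6)] s1 ord by auto
      then have i: "inside {x, y} t Down" using s1 jump_down(4) by (simp add: inside_def)
      then have "b = y"
        using B True i inside_unique[OF True _ i] unfolding base_of_def by blast
      moreover have "\<not> inside {y, x} s Down"
        using s1 by (simp add: inside_def insert_commute)
      then have "base_of (y, s, Down) y" using after by (intro base_ofI) blast
      ultimately show ?thesis using jump_down(2) k by auto
    qed
  next
    case False
    then have "b = x" using other by (intro base_of_non_inside[OF B]) blast
    moreover have "base_of (y, s, turn k Down) y"
      using after False by (intro base_ofI) (auto simp: insert_commute)
    moreover have "{x, y} \<in> linked"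
      using False jump_down(7) by (auto simp: linked_def link_at_def)
    ultimately show ?thesis using jump_down(2) by auto
  qed
next
  case (wrap_up x)
  have "b = x" using wrap_up order
    by (intro base_of_non_inside[of x \<beta> Up]) (force simp: inside_def)+
  moreover have "base_of (x, 0, Up) x"
    using order by (intro base_ofI) (force simp: inside_def)
  ultimately show ?case using wrap_up by auto
next
  case (wrap_down x)
  have "b = x" using wrap_down order
    by (intro base_of_non_inside[of x 0 Down]) (force simp: inside_def)+
  moreover have "base_of (x, \<beta>, Down) x"
    using order by (intro base_ofI) (force simp: inside_def)
  ultimately show ?case using wrap_down by auto
qed

lemma trajectory_base:
  assumes "(motion E \<beta> X)\<^sup>*\<^sup>* \<sigma> \<sigma>'" and "base_of \<sigma> b"
  shows "\<exists>b'. base_of \<sigma>' b' \<and> b' \<in> component linked b"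
  using assms
proof (induction rule: rtranclp_induct)
  case base
  then show ?case by (auto simp: component_def)
next
  case (step \<tau> \<tau>')
  then obtain b\<^sub>1 where b1: "base_of \<tau> b\<^sub>1" "b\<^sub>1 \<in> component linked b" by blast
  obtain b\<^sub>2 where "base_of \<tau>' b\<^sub>2" "b\<^sub>2 = b\<^sub>1 \<or> {b\<^sub>1, b\<^sub>2} \<in> linked"
    using motion_base[OF step(2) b1(1)] by blast
  then show ?case using b1(2)
    by (auto simp: component_def intro: rtrancl_into_rtrancl)
qed

text \<open>
  The two crosses of a blocked edge lie strictly between the times \<open>0\<close> and \<open>\<beta>\<close>.
\<close>

lemma base_at_time_0: "base_of (x, 0, d) b \<Longrightarrow> b = x"
  using order by (intro base_of_non_inside) (force simp: inside_def split: direction.splits)+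

lemma loop_vertices_subset_component: "loop_vertices V E \<beta> X v \<subseteq> component linked v"
proof
  fix w assume "w \<in> loop_vertices V E \<beta> X v"
  then obtain x t d d' where
    "(motion E \<beta> X)\<^sup>*\<^sup>* (x, t, Up) (v, 0, d)" "(motion E \<beta> X)\<^sup>*\<^sup>* (x, t, Up) (w, 0, d')"
    by (auto simp: loop_vertices_def same_loop_def loop_def)
  moreover obtain b where "base_of (x, t, Up) b" using base_exists by blast
  ultimately have "v \<in> component linked b" "w \<in> component linked b"
    using trajectory_base base_at_time_0 by blast+
  moreover have "sym ({(x, y). {x, y} \<in> linked}\<^sup>*)"
    by (intro sym_rtrancl) (auto simp: sym_def insert_commute)
  ultimately show "w \<in> component linked v"
    by (auto simp: component_def dest: symD intro: rtrancl_trans)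
qed

end

section \<open>Labels of a link configuration\<close>

text \<open>
  Window \<open>i \<le> m\<close> is the half-open interval from \<open>i * \<beta> / (m + 1)\<close> to \<open>(i + 1) * \<beta> / (m + 1)\<close>. Negative
  times fall into window \<open>0\<close>, which is harmless since no edge is blocked there, and the time \<open>\<beta>\<close>
  falls into window \<open>m + 1\<close>, which no label uses.
\<close>

definition window :: "real \<Rightarrow> nat \<Rightarrow> real \<Rightarrow> nat" where
  "window \<beta> m t = nat \<lfloor>t * (real m + 1) / \<beta>\<rfloor>"

text \<open>
  The arguments \<open>c\<close> and \<open>b\<close> are the crosses and the double bars of an edge. The two crosses are
  required to be listed in increasing order, which excludes coincidence and costs only a factor
  \<open>1 / 2\<close> in probability.
\<close>

definition link_label :: "real \<Rightarrow> nat \<Rightarrow> point_sample \<Rightarrow> point_sample \<Rightarrow> label" where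
  "link_label \<beta> m c b =
    (let t = snd c 0; t' = snd c 1; i = window \<beta> m t in
     if fst b \<noteq> 0 then Other
     else if fst c = 0 then Vacant
     else if fst c = 1 \<and> i \<le> m then Single_Cross i
     else if fst c = 2 \<and> 1 \<le> i \<and> i \<le> m \<and> window \<beta> m t' = i \<and> t < t' then Cross_Pair i
     else Other)"

definition edge_label :: "real \<Rightarrow> nat \<Rightarrow> 'a link_config \<Rightarrow> 'a set \<Rightarrow> label" where
  "edge_label \<beta> m X e = link_label \<beta> m (X (e, Cross)) (X (e, Double_Bar))"

definition meets :: "'a set \<Rightarrow> 'a set \<Rightarrow> bool" where
  "meets e f \<longleftrightarrow> e \<noteq> f \<and> e \<inter> f \<noteq> {}"

lemma edge_label_mem: "edge_label \<beta> m X e \<in> labels m"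
  by (auto simp: edge_label_def link_label_def labels_def Let_def)

lemma window_mono: "0 < \<beta> \<Longrightarrow> s \<le> t \<Longrightarrow> window \<beta> m s \<le> window \<beta> m t"
  unfolding window_def by (intro nat_mono floor_mono divide_right_mono mult_right_mono) auto

lemma window_eqI:
  assumes "0 < \<beta>" and "real i * \<beta> / (real m + 1) \<le> t" and "t < (real i + 1) * \<beta> / (real m + 1)"
  shows "window \<beta> m t = i"
proof -
  have "real i \<le> t * (real m + 1) / \<beta>" "t * (real m + 1) / \<beta> < real i + 1"
    using assms by (simp_all add: field_simps)
  then have "\<lfloor>t * (real m + 1) / \<beta>\<rfloor> = int i" by (intro floor_unique) auto
  then show ?thesis by (simp add: window_def)
qed

lemma points_window:
  assumes "edge_label \<beta> m X e \<noteq> Other" and "t \<in> points (X (e, k))"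
  shows "occupies (edge_label \<beta> m X e) (window \<beta> m t)"
proof -
  have "{..<2::nat} = {0, 1}" by auto
  then show ?thesis
    using assms
    by (cases k) (auto simp: edge_label_def link_label_def Let_def points_def split: if_splits)
qed

lemma edge_label_Cross_Pair:
  assumes "0 < \<beta>" and "edge_label \<beta> m X e = Cross_Pair i"
  defines "s \<equiv> snd (X (e, Cross)) 0" and "t \<equiv> snd (X (e, Cross)) 1"
  shows "points (X (e, Cross)) = {s, t}" and "points (X (e, Double_Bar)) = {}"
    and "0 < s" and "s < t" and "t < \<beta>" and "window \<beta> m s = i" and "window \<beta> m t = i"
proof -
  have st: "fst (X (e, Double_Bar)) = 0" "fst (X (e, Cross)) = 2" "1 \<le> i" "i \<le> m"
    "window \<beta> m s = i" "window \<beta> m t = i" "s < t"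
    using assms(2) by (auto simp: edge_label_def link_label_def Let_def s_def t_def split: if_splits)
  have "{..<2::nat} = {0, 1}" by auto
  then show "points (X (e, Cross)) = {s, t}" "points (X (e, Double_Bar)) = {}"
    using st by (auto simp: points_def s_def t_def)
  show "s < t" "window \<beta> m s = i" "window \<beta> m t = i" by fact+
  have "1 \<le> \<lfloor>s * (real m + 1) / \<beta>\<rfloor>"
    using st(3,5) unfolding window_def by linarith
  then have "0 < s * (real m + 1) / \<beta>" by linarith
  then show "0 < s" using assms(1) by (simp add: zero_less_divide_iff zero_less_mult_iff)
  have "\<lfloor>t * (real m + 1) / \<beta>\<rfloor> \<le> int m"
    using st(4,6) unfolding window_def by linarith
  then have "t * (real m + 1) / \<beta> < real m + 1" by linarith
  then show "t < \<beta>" using assms(1) by (simp add: divide_less_eq)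
qed

text \<open>
  Two links in the same window have only times of that window between them, and an adjacent edge
  without a link in the window does not interfere.
\<close>

lemma blocked_links_blocked:
  fixes X :: "'a link_config"
  assumes "0 < \<beta>"
  shows "blocked_links E \<beta> X (blocked meets E (edge_label \<beta> m X))
    (\<lambda>e. snd (X (e, Cross)) 0) (\<lambda>e. snd (X (e, Cross)) 1)"
proof
  let ?D = "blocked meets E (edge_label \<beta> m X)"
  show "?D \<subseteq> E" by (auto simp: blocked_def)
  fix e assume "e \<in> ?D"
  then obtain i where i: "e \<in> E" "edge_label \<beta> m X e = Cross_Pair i"
    and free: "\<And>f. f \<in> E \<Longrightarrow> meets e f \<Longrightarrow> \<not> occupies (edge_label \<beta> m X f) i"
    by (auto simp: blocked_def)
  note P = edge_label_Cross_Pair[OF assms i(2)]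
  show "0 < snd (X (e, Cross)) 0 \<and> snd (X (e, Cross)) 0 < snd (X (e, Cross)) 1 \<and>
      snd (X (e, Cross)) 1 < \<beta>"
    "points (X (e, Cross)) = {snd (X (e, Cross)) 0, snd (X (e, Cross)) 1}"
    "points (X (e, Double_Bar)) = {}" using P by auto
  fix f t k assume f: "f \<in> E" "f \<noteq> e" "f \<inter> e \<noteq> {}" "t \<in> points (X (f, k))"
  have nocc: "\<not> occupies (edge_label \<beta> m X f) i" using f free by (auto simp: meets_def)
  then have "edge_label \<beta> m X f \<noteq> Other" by auto
  then have "occupies (edge_label \<beta> m X f) (window \<beta> m t)" using f(4) by (rule points_window)
  then have "window \<beta> m t \<noteq> i" using nocc by metis
  then show "t \<notin> {snd (X (e, Cross)) 0..snd (X (e, Cross)) 1}"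
    using P(6,7) window_mono[OF assms, of "snd (X (e, Cross)) 0" t m]
      window_mono[OF assms, of t "snd (X (e, Cross)) 1" m] by auto
qed

lemma loop_vertices_subset_effective:
  assumes "0 < \<beta>"
  shows "loop_vertices V E \<beta> X v \<subseteq> component (effective meets E (edge_label \<beta> m X)) v"
proof -
  interpret blocked_links E \<beta> X "blocked meets E (edge_label \<beta> m X)"
    "\<lambda>e. snd (X (e, Cross)) 0" "\<lambda>e. snd (X (e, Cross)) 1"
    by (rule blocked_links_blocked[OF assms])
  have "edge_label \<beta> m X e \<noteq> Vacant" if "t \<in> points (X (e, k))" for e t k
    using that points_window[of \<beta> m X e t k] by auto
  then have "linked \<subseteq> effective meets E (edge_label \<beta> m X)"
    by (auto simp: linked_def effective_def occupied_def)
  then show ?thesis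
    using loop_vertices_subset_component[of V v] component_mono[of linked _ v] by blast
qed

text \<open>
  The status of an edge depends only on its own label and on those of its neighbours.
\<close>

lemma effective_local:
  assumes "F \<subseteq> E" and "e \<in> F" and "\<And>f. f \<in> E \<Longrightarrow> meets e f \<Longrightarrow> f \<in> F"
  shows "e \<in> effective meets E x \<longleftrightarrow> e \<in> effective meets F (restrict x F)"
proof -
  have "(\<forall>f\<in>E. meets e f \<longrightarrow> \<not> occupies (x f) i) \<longleftrightarrow>
      (\<forall>f\<in>F. meets e f \<longrightarrow> \<not> occupies (restrict x F f) i)" for i
    using assms(1,3) by (metis restrict_apply' subsetD)
  moreover have "e \<in> E" using assms(1,2) by blast
  ultimately show ?thesis
    using assms(2) by (simp add: effective_def occupied_def blocked_def)
qed

section \<open>The law of the labels\<close>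

lemma pmf_poisson0:
  assumes "0 \<le> r"
  shows "pmf (poisson0_pmf r) n = r ^ n / fact n * exp (- r)"
  using assms by (cases "r = 0"; cases n) (auto simp: poisson0_pmf_def)

lemma prob_space_uniform_interval:
  fixes \<beta> :: real
  assumes "0 < \<beta>"
  shows "prob_space (uniform_measure lborel {0..\<beta>})"
  using assms by (intro prob_space_uniform_measure) auto

lemma prob_space_poisson_process:
  assumes "0 < \<beta>"
  shows "prob_space (poisson_process r \<beta>)"
  unfolding poisson_process_def using prob_space_uniform_interval[OF assms]
  by (intro prob_space_pair prob_space_measure_pmf prob_space_PiM)

lemma sets_poisson_process:
  "sets (poisson_process r \<beta>) = sets (count_space UNIV \<Otimes>\<^sub>M PiM UNIV (\<lambda>_::nat. borel))"
  unfolding poisson_process_def by (intro sets_pair_measure_cong sets_PiM_cong) auto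

text \<open>
  Samples with exactly \<open>n\<close> points in which the \<open>j\<close>-th point lies in \<open>A j\<close>; the points are not sorted.
\<close>

definition arrivals :: "nat \<Rightarrow> (nat \<Rightarrow> real set) \<Rightarrow> point_sample set" where
  "arrivals n A = {s. fst s = n \<and> (\<forall>j<n. snd s j \<in> A j)}"

lemma arrivals_poisson_process:
  assumes \<beta>: "0 < \<beta>" and ab: "\<And>j. j < n \<Longrightarrow> 0 \<le> a j \<and> a j \<le> b j \<and> b j \<le> \<beta>"
  shows "arrivals n (\<lambda>j. {a j..<b j}) \<in> sets (poisson_process r \<beta>)"
    and "emeasure (poisson_process r \<beta>) (arrivals n (\<lambda>j. {a j..<b j})) =
      ennreal (pmf (poisson0_pmf (r * \<beta>)) n * (\<Prod>j<n. (b j - a j) / \<beta>))"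
proof -
  let ?U = "\<lambda>_::nat. uniform_measure lborel {0..\<beta>}"
  let ?B = "{w \<in> space (PiM UNIV ?U). \<forall>j\<in>{..<n}. w j \<in> {a j..<b j}}"
  interpret U: prob_space "uniform_measure lborel {0..\<beta>}" by (rule prob_space_uniform_interval[OF \<beta>])
  interpret P: product_prob_space ?U UNIV by unfold_locales
  have eq: "arrivals n (\<lambda>j. {a j..<b j}) = {n} \<times> ?B"
    by (auto simp: arrivals_def space_PiM)
  have B: "?B \<in> sets (PiM UNIV ?U)"
    by (intro sets.sets_Collect_finite_All sets_Collect_single) auto
  show "arrivals n (\<lambda>j. {a j..<b j}) \<in> sets (poisson_process r \<beta>)"
    unfolding eq poisson_process_def using B by (intro pair_measureI) auto
  have "emeasure (poisson_process r \<beta>) (arrivals n (\<lambda>j. {a j..<b j})) =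
      emeasure (measure_pmf (poisson0_pmf (r * \<beta>))) {n} * emeasure (PiM UNIV ?U) ?B"
    unfolding eq poisson_process_def using B by (intro P.P.emeasure_pair_measure_Times) auto
  also have "emeasure (PiM UNIV ?U) ?B = (\<Prod>j<n. emeasure (uniform_measure lborel {0..\<beta>}) {a j..<b j})"
    by (intro P.emeasure_PiM_Collect) auto
  also have "\<dots> = (\<Prod>j<n. ennreal ((b j - a j) / \<beta>))"
  proof (intro prod.cong refl)
    fix j assume "j \<in> {..<n}"
    then have j: "0 \<le> a j" "a j \<le> b j" "b j \<le> \<beta>" using ab by auto
    then have "{0..\<beta>} \<inter> {a j..<b j} = {a j..<b j}" by auto
    then show "emeasure (uniform_measure lborel {0..\<beta>}) {a j..<b j} = ennreal ((b j - a j) / \<beta>)"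
      using j \<beta> by (simp add: divide_ennreal)
  qed
  also have "\<dots> = ennreal (\<Prod>j<n. (b j - a j) / \<beta>)"
    using ab \<beta> by (intro prod_ennreal) auto
  finally show "emeasure (poisson_process r \<beta>) (arrivals n (\<lambda>j. {a j..<b j})) =
      ennreal (pmf (poisson0_pmf (r * \<beta>)) n * (\<Prod>j<n. (b j - a j) / \<beta>))"
    using ab \<beta> by (simp add: emeasure_pmf_single ennreal_mult' prod_nonneg)
qed

lemma prob_space_loop_measure: "0 < \<beta> \<Longrightarrow> prob_space (loop_measure E \<beta> u)"
  unfolding loop_measure_def
  by (intro prob_space_PiM) (auto simp: prob_space_poisson_process split: prod.splits)

lemma measurable_link_label:
  assumes "f \<in> measurable M (poisson_process r \<beta>')" and "g \<in> measurable M (poisson_process r' \<beta>'')"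
  shows "(\<lambda>\<omega>. link_label \<beta> m (f \<omega>) (g \<omega>)) \<in> measurable M (count_space UNIV)"
proof -
  let ?P = "count_space UNIV \<Otimes>\<^sub>M PiM UNIV (\<lambda>_::nat. borel :: real measure)"
  have fg: "f \<in> measurable M ?P" "g \<in> measurable M ?P"
    using assms by (simp_all add: measurable_cong_sets[OF refl sets_poisson_process])
  have win: "window \<beta> m \<in> measurable borel (count_space UNIV)"
    unfolding window_def by measurable
  have snd: "(\<lambda>\<omega>. snd (f \<omega>) j) \<in> borel_measurable M" for j
    using measurable_compose[OF measurable_compose[OF fg(1) measurable_snd]
        measurable_component_singleton[of j]] by simp
  have ff: "(\<lambda>\<omega>. fst (f \<omega>)) \<in> measurable M (count_space UNIV)"
    and fg': "(\<lambda>\<omega>. fst (g \<omega>)) \<in> measurable M (count_space UNIV)"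
    using measurable_compose[OF fg(1) measurable_fst] measurable_compose[OF fg(2) measurable_fst]
    by simp_all
  define t t' where "t = (\<lambda>\<omega>. snd (f \<omega>) 0)" and "t' = (\<lambda>\<omega>. snd (f \<omega>) 1)"
  have t: "t \<in> borel_measurable M" "t' \<in> borel_measurable M"
    unfolding t_def t'_def by (rule snd)+
  define i i' where "i = (\<lambda>\<omega>. window \<beta> m (t \<omega>))" and "i' = (\<lambda>\<omega>. window \<beta> m (t' \<omega>))"
  have i: "i \<in> measurable M (count_space UNIV)" "i' \<in> measurable M (count_space UNIV)"
    unfolding i_def i'_def using t by (auto intro: measurable_compose[OF _ win])
  \<comment> \<open>Any property of a measurable discrete variable is measurable.\<close>
  have discrete: "{\<omega> \<in> space M. Q (h \<omega>)} \<in> sets M"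
    if "h \<in> measurable M (count_space UNIV)" for h :: "_ \<Rightarrow> nat" and Q
    using measurable_sets[OF that, of "{n. Q n}"] by (simp add: vimage_def Int_def conj_commute)
  have labels: "(\<lambda>\<omega>. Single_Cross (i \<omega>)) \<in> measurable M (count_space UNIV)"
    "(\<lambda>\<omega>. Cross_Pair (i \<omega>)) \<in> measurable M (count_space UNIV)"
    by (rule measurable_compose[OF i(1)], simp)+
  have real_i: "(\<lambda>\<omega>. real (i \<omega>)) \<in> borel_measurable M" "(\<lambda>\<omega>. real (i' \<omega>)) \<in> borel_measurable M"
    by (rule measurable_compose[OF i(1)], simp, rule measurable_compose[OF i(2)], simp)
  have same: "{\<omega> \<in> space M. i' \<omega> = i \<omega>} \<in> sets M"
    using borel_measurable_eq[OF real_i(2,1)] by simp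
  have less: "{\<omega> \<in> space M. t \<omega> < t' \<omega>} \<in> sets M" by (rule borel_measurable_less[OF t])
  have "(\<lambda>\<omega>. if fst (g \<omega>) \<noteq> 0 then Other
     else if fst (f \<omega>) = 0 then Vacant
     else if fst (f \<omega>) = 1 \<and> i \<omega> \<le> m then Single_Cross (i \<omega>)
     else if fst (f \<omega>) = 2 \<and> 1 \<le> i \<omega> \<and> i \<omega> \<le> m \<and> i' \<omega> = i \<omega> \<and> t \<omega> < t' \<omega> then Cross_Pair (i \<omega>)
     else Other) \<in> measurable M (count_space UNIV)"
    by (intro measurable_If labels measurable_const sets.sets_Collect_conj same less
        discrete[OF ff] discrete[OF fg'] discrete[OF i(1)]) simp_all
  then show ?thesis unfolding link_label_def Let_def i_def i'_def t_def t'_def .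
qed

lemma measurable_edge_label:
  assumes "e \<in> E"
  shows "(\<lambda>X. edge_label \<beta> m X e) \<in> measurable (loop_measure E \<beta> u) (count_space UNIV)"
  unfolding edge_label_def loop_measure_def
proof (rule measurable_link_label)
  show "(\<lambda>X. X (e, Cross)) \<in> measurable
      (PiM (E \<times> UNIV) (\<lambda>(e, k). poisson_process (intensity u k) \<beta>)) (poisson_process (intensity u Cross) \<beta>)"
    using assms measurable_component_singleton[of "(e, Cross)" "E \<times> UNIV"
        "\<lambda>(e, k). poisson_process (intensity u k) \<beta>"] by simp
  show "(\<lambda>X. X (e, Double_Bar)) \<in> measurable
      (PiM (E \<times> UNIV) (\<lambda>(e, k). poisson_process (intensity u k) \<beta>)) (poisson_process (intensity u Double_Bar) \<beta>)"
    using assms measurable_component_singleton[of "(e, Double_Bar)" "E \<times> UNIV"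
        "\<lambda>(e, k). poisson_process (intensity u k) \<beta>"] by simp
qed

text \<open>
  The label of \<open>e\<close> is a function of the coordinates \<open>(e, Cross)\<close> and \<open>(e, Double_Bar)\<close> of the product
  space, and these pairs are disjoint for different edges.
\<close>

lemma indep_edge_labels:
  assumes \<beta>: "0 < \<beta>" and E: "E \<noteq> {}"
  shows "prob_space.indep_vars (loop_measure E \<beta> u) (\<lambda>_. count_space UNIV)
    (\<lambda>e X. edge_label \<beta> m X e) E"
proof -
  define M where "M = (\<lambda>(e :: 'a set, k). poisson_process (intensity u k) \<beta>)"
  have N: "loop_measure E \<beta> u = PiM (E \<times> UNIV) M" by (simp add: loop_measure_def M_def)
  have M: "prob_space (M i)" for i
    using prob_space_poisson_process[OF \<beta>] by (auto simp: M_def split: prod.splits)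
  interpret prob_space "loop_measure E \<beta> u" by (rule prob_space_loop_measure[OF \<beta>])
  have "indep_vars M (\<lambda>i X. X i) (E \<times> UNIV)"
  proof (subst indep_vars_iff_distr_eq_PiM')
    show "E \<times> (UNIV :: link_kind set) \<noteq> {}" using E by auto
    show "random_variable (M i) (\<lambda>X. X i)" if "i \<in> E \<times> UNIV" for i
      using that by (simp add: N)
    have "distr (PiM (E \<times> UNIV) M) (PiM (E \<times> UNIV) M) (\<lambda>X. \<lambda>i\<in>E \<times> UNIV. X i) =
        distr (PiM (E \<times> UNIV) M) (PiM (E \<times> UNIV) M) (\<lambda>X. X)"
      by (intro distr_cong) (auto simp: space_PiM PiE_def extensional_restrict)
    also have "\<dots> = PiM (E \<times> UNIV) M" by simp
    also have "\<dots> = PiM (E \<times> UNIV) (\<lambda>i. distr (PiM (E \<times> UNIV) M) (M i) (\<lambda>X. X i))"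
      using M by (intro PiM_cong distr_PiM_component[symmetric]) auto
    finally show "distr (loop_measure E \<beta> u) (PiM (E \<times> UNIV) M) (\<lambda>X. \<lambda>i\<in>E \<times> UNIV. X i) =
        PiM (E \<times> UNIV) (\<lambda>i. distr (loop_measure E \<beta> u) (M i) (\<lambda>X. X i))"
      unfolding N .
  qed
  then have "indep_vars (\<lambda>e. PiM ({e} \<times> UNIV) M) (\<lambda>e X. restrict (\<lambda>i. X i) ({e} \<times> UNIV)) E"
    by (rule indep_vars_restrict) (auto simp: disjoint_family_on_def)
  then have "indep_vars (\<lambda>_. count_space UNIV)
      (\<lambda>e X. edge_label \<beta> m (restrict (\<lambda>i. X i) ({e} \<times> UNIV)) e) E"
  proof (rule indep_vars_compose2)
    fix e assume "e \<in> E"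
    show "(\<lambda>X. edge_label \<beta> m X e) \<in> measurable (PiM ({e} \<times> UNIV) M) (count_space UNIV)"
      using measurable_edge_label[of e "{e}"] by (simp add: loop_measure_def M_def)
  qed
  then show ?thesis by (simp add: edge_label_def)
qed

definition label_prob :: "'a set set \<Rightarrow> real \<Rightarrow> real \<Rightarrow> nat \<Rightarrow> 'a set \<Rightarrow> label \<Rightarrow> real" where
  "label_prob E \<beta> u m e l =
    measure (loop_measure E \<beta> u) {X \<in> space (loop_measure E \<beta> u). edge_label \<beta> m X e = l}"

lemma edge_label_sets:
  assumes "e \<in> E"
  shows "{X \<in> space (loop_measure E \<beta> u). edge_label \<beta> m X e = l} \<in> sets (loop_measure E \<beta> u)"
  using measurable_sets[OF measurable_edge_label[OF assms], of "{l}" \<beta> m u]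
  by (simp add: vimage_def Int_def conj_commute)

lemma edge_labels_law:
  fixes u :: real
  assumes \<beta>: "0 < \<beta>" and F: "finite F" "F \<subseteq> E"
  defines "N \<equiv> loop_measure E \<beta> u"
  shows "{X \<in> space N. \<forall>e\<in>F. edge_label \<beta> m X e = x e} \<in> sets N"
    and "emeasure N {X \<in> space N. \<forall>e\<in>F. edge_label \<beta> m X e = x e} =
      ennreal (\<Prod>e\<in>F. label_prob E \<beta> u m e (x e))"
proof -
  show "{X \<in> space N. \<forall>e\<in>F. edge_label \<beta> m X e = x e} \<in> sets N"
    unfolding N_def using F(2) by (intro sets.sets_Collect_finite_All F(1) edge_label_sets) auto
  interpret prob_space N unfolding N_def by (rule prob_space_loop_measure[OF \<beta>])
  show "emeasure N {X \<in> space N. \<forall>e\<in>F. edge_label \<beta> m X e = x e} =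
      ennreal (\<Prod>e\<in>F. label_prob E \<beta> u m e (x e))"
  proof (cases "F = {}")
    case True
    then show ?thesis by (simp add: emeasure_space_1)
  next
    case False
    then have "indep_vars (\<lambda>_. count_space UNIV) (\<lambda>e X. edge_label \<beta> m X e) E"
      using indep_edge_labels[OF \<beta>, of E] F by (auto simp: N_def)
    then have "prob (\<Inter>e\<in>F. (\<lambda>X. edge_label \<beta> m X e) -` {x e} \<inter> space N) =
        (\<Prod>e\<in>F. prob ((\<lambda>X. edge_label \<beta> m X e) -` {x e} \<inter> space N))"
      using False F by (intro indep_varsD[where I = E and M' = "\<lambda>_. count_space UNIV"]) auto
    moreover have "(\<Inter>e\<in>F. (\<lambda>X. edge_label \<beta> m X e) -` {x e} \<inter> space N) =
        {X \<in> space N. \<forall>e\<in>F. edge_label \<beta> m X e = x e}" using False by auto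
    moreover have "(\<lambda>X. edge_label \<beta> m X e) -` {x e} \<inter> space N =
        {X \<in> space N. edge_label \<beta> m X e = x e}" for e by auto
    ultimately have "prob {X \<in> space N. \<forall>e\<in>F. edge_label \<beta> m X e = x e} =
        (\<Prod>e\<in>F. label_prob E \<beta> u m e (x e))"
      unfolding label_prob_def N_def[symmetric] by simp
    then show ?thesis unfolding emeasure_eq_measure by simp
  qed
qed

lemma sum_label_prob:
  assumes \<beta>: "0 < \<beta>" and e: "e \<in> E"
  shows "(\<Sum>l\<in>labels m. label_prob E \<beta> u m e l) = 1"
proof -
  let ?N = "loop_measure E \<beta> u"
  interpret prob_space ?N by (rule prob_space_loop_measure[OF \<beta>])
  have "(\<Sum>l\<in>labels m. label_prob E \<beta> u m e l) =
      prob (\<Union>l\<in>labels m. {X \<in> space ?N. edge_label \<beta> m X e = l})"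
    unfolding label_prob_def using edge_label_sets[OF e]
    by (intro finite_measure_finite_Union[symmetric]) (auto simp: disjoint_family_on_def)
  also have "(\<Union>l\<in>labels m. {X \<in> space ?N. edge_label \<beta> m X e = l}) = space ?N"
    using edge_label_mem by blast
  finally show ?thesis by (simp add: prob_space)
qed

text \<open>
  The two Poisson processes on an edge have total intensity \<open>1\<close>, whence the factor \<open>exp (- \<beta>)\<close> not
  depending on \<open>u\<close>.
\<close>

lemma arrivals_prob:
  fixes a b :: "nat \<Rightarrow> real"
  assumes \<beta>: "0 < \<beta>" and u: "0 \<le> u" "u \<le> 1" and e: "e \<in> E"
    and ab: "\<And>j. j < n \<Longrightarrow> 0 \<le> a j \<and> a j \<le> b j \<and> b j \<le> \<beta>"
  shows "measure (loop_measure E \<beta> u) {X \<in> space (loop_measure E \<beta> u).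
      X (e, Cross) \<in> arrivals n (\<lambda>j. {a j..<b j}) \<and> fst (X (e, Double_Bar)) = 0} =
    exp (- \<beta>) * ((u * \<beta>) ^ n / fact n) * (\<Prod>j<n. (b j - a j) / \<beta>)"
proof -
  let ?M = "\<lambda>(e :: 'a set, k). poisson_process (intensity u k) \<beta>"
  let ?N = "PiM (E \<times> UNIV) ?M"
  let ?A = "arrivals n (\<lambda>j. {a j..<b j})" and ?B = "arrivals 0 (\<lambda>j. {0..<0})"
  let ?J = "{(e, Cross), (e, Double_Bar)}"
  let ?Y = "\<lambda>i. if i = (e, Cross) then ?A else ?B"
  interpret P: product_prob_space ?M "E \<times> UNIV"
    using prob_space_poisson_process[OF \<beta>]
    by (intro product_prob_spaceI) (auto split: prod.splits)
  have A: "?A \<in> sets (poisson_process r \<beta>)"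
    "emeasure (poisson_process r \<beta>) ?A =
      ennreal (pmf (poisson0_pmf (r * \<beta>)) n * (\<Prod>j<n. (b j - a j) / \<beta>))" for r
    using arrivals_poisson_process[OF \<beta>, of n a b r] ab by blast+
  have B: "?B \<in> sets (poisson_process r \<beta>)"
    "emeasure (poisson_process r \<beta>) ?B = ennreal (pmf (poisson0_pmf (r * \<beta>)) 0)" for r
    using arrivals_poisson_process[OF \<beta>, of 0 "\<lambda>_. 0" "\<lambda>_. 0" r] by simp_all
  have sets_eq: "{X \<in> space ?N. X (e, Cross) \<in> ?A \<and> fst (X (e, Double_Bar)) = 0} =
      {X \<in> space ?N. \<forall>i\<in>?J. X i \<in> ?Y i}"
    by (auto simp: arrivals_def)
  have "emeasure ?N {X \<in> space ?N. X (e, Cross) \<in> ?A \<and> fst (X (e, Double_Bar)) = 0} =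
      emeasure ?N {X \<in> space ?N. \<forall>i\<in>?J. X i \<in> ?Y i}"
    unfolding sets_eq ..
  also have "emeasure ?N {X \<in> space ?N. \<forall>i\<in>?J. X i \<in> ?Y i} =
      (\<Prod>i\<in>?J. emeasure (?M i) (?Y i))"
    using e A(1) B(1) by (intro P.emeasure_PiM_Collect) auto
  also have "(\<Prod>i\<in>?J. emeasure (?M i) (?Y i)) =
      emeasure (poisson_process u \<beta>) ?A * emeasure (poisson_process (1 - u) \<beta>) ?B" by simp
  also have "\<dots> = ennreal (pmf (poisson0_pmf (u * \<beta>)) n * (\<Prod>j<n. (b j - a j) / \<beta>) *
      pmf (poisson0_pmf ((1 - u) * \<beta>)) 0)"
    unfolding A(2) B(2) by (rule ennreal_mult''[symmetric]) simp
  also have "pmf (poisson0_pmf (u * \<beta>)) n * (\<Prod>j<n. (b j - a j) / \<beta>) *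
      pmf (poisson0_pmf ((1 - u) * \<beta>)) 0 =
      exp (- \<beta>) * ((u * \<beta>) ^ n / fact n) * (\<Prod>j<n. (b j - a j) / \<beta>)"
  proof -
    have "exp (- (u * \<beta>)) * exp (- ((1 - u) * \<beta>)) = exp (- \<beta>)"
      by (simp add: exp_add[symmetric] algebra_simps)
    then show ?thesis using \<beta> u
      by (simp add: pmf_poisson0 mult_ac)
  qed
  finally have "emeasure ?N {X \<in> space ?N. X (e, Cross) \<in> ?A \<and> fst (X (e, Double_Bar)) = 0} =
      ennreal (exp (- \<beta>) * ((u * \<beta>) ^ n / fact n) * (\<Prod>j<n. (b j - a j) / \<beta>))" .
  moreover have "0 \<le> exp (- \<beta>) * ((u * \<beta>) ^ n / fact n) * (\<Prod>j<n. (b j - a j) / \<beta>)"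
    using \<beta> u ab by (intro mult_nonneg_nonneg prod_nonneg) auto
  ultimately show ?thesis
    unfolding loop_measure_def by (intro measure_eq_emeasure_eq_ennreal)
qed

lemma label_prob_Vacant:
  assumes "0 < \<beta>" and "0 \<le> u" and "u \<le> 1" and "e \<in> E"
  shows "label_prob E \<beta> u m e Vacant = exp (- \<beta>)"
proof -
  have "edge_label \<beta> m X e = Vacant \<longleftrightarrow>
      X (e, Cross) \<in> arrivals 0 (\<lambda>j. {0..<0}) \<and> fst (X (e, Double_Bar)) = 0" for X :: "'a link_config"
    by (auto simp: edge_label_def link_label_def Let_def arrivals_def)
  then show ?thesis
    using arrivals_prob[OF assms, of 0 "\<lambda>_. 0" "\<lambda>_. 0"] by (simp add: label_prob_def)
qed

lemma label_prob_ge: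
  fixes a b :: "nat \<Rightarrow> real"
  assumes \<beta>: "0 < \<beta>" and u: "0 \<le> u" "u \<le> 1" and e: "e \<in> E"
    and ab: "\<And>j. j < n \<Longrightarrow> 0 \<le> a j \<and> a j \<le> b j \<and> b j \<le> \<beta>"
    and imp: "\<And>c b'. c \<in> arrivals n (\<lambda>j. {a j..<b j}) \<Longrightarrow> fst b' = 0 \<Longrightarrow> link_label \<beta> m c b' = l"
  shows "exp (- \<beta>) * ((u * \<beta>) ^ n / fact n) * (\<Prod>j<n. (b j - a j) / \<beta>) \<le> label_prob E \<beta> u m e l"
proof -
  interpret prob_space "loop_measure E \<beta> u" by (rule prob_space_loop_measure[OF \<beta>])
  have "exp (- \<beta>) * ((u * \<beta>) ^ n / fact n) * (\<Prod>j<n. (b j - a j) / \<beta>) =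
      prob {X \<in> space (loop_measure E \<beta> u).
        X (e, Cross) \<in> arrivals n (\<lambda>j. {a j..<b j}) \<and> fst (X (e, Double_Bar)) = 0}"
    using arrivals_prob[OF \<beta> u e, of n a b] ab by simp
  also have "\<dots> \<le> label_prob E \<beta> u m e l"
    unfolding label_prob_def
  proof (intro finite_measure_mono edge_label_sets e subsetI)
    fix X :: "'a link_config"
    assume "X \<in> {X \<in> space (loop_measure E \<beta> u).
        X (e, Cross) \<in> arrivals n (\<lambda>j. {a j..<b j}) \<and> fst (X (e, Double_Bar)) = 0}"
    then show "X \<in> {X \<in> space (loop_measure E \<beta> u). edge_label \<beta> m X e = l}"
      using imp[of "X (e, Cross)" "X (e, Double_Bar)"] by (simp add: edge_label_def)
  qed
  finally show ?thesis .
qed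

text \<open>
  A common lower bound for the probabilities of all labels that \<open>block_edge\<close> introduces.
  It is continuous in \<open>\<beta>\<close>.
\<close>

definition label_bound :: "real \<Rightarrow> nat \<Rightarrow> real \<Rightarrow> real" where
  "label_bound u m \<beta> = min (exp (- \<beta>) * (u * \<beta>) ^ 2 / (8 * (real m + 1) ^ 2))
     (exp (- \<beta>) * (u * \<beta>) / (real m + 1))"

lemma label_bound_pos: "0 < u \<Longrightarrow> 0 < \<beta> \<Longrightarrow> 0 < label_bound u m \<beta>"
  by (simp add: label_bound_def)

lemma label_prob_Single_Cross:
  assumes \<beta>: "0 < \<beta>" and u: "0 \<le> u" "u \<le> 1" and e: "e \<in> E" and i: "i \<le> m"
  shows "label_bound u m \<beta> \<le> label_prob E \<beta> u m e (Single_Cross i)"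
proof -
  define w where "w = \<beta> / (real m + 1)"
  have w: "0 < w" using \<beta> by (simp add: w_def)
  have top: "(real i + 1) * w \<le> \<beta>"
    using mult_right_mono[of "real i + 1" "real m + 1" w] i w by (simp add: w_def)
  have "exp (- \<beta>) * ((u * \<beta>) ^ 1 / fact 1) * (\<Prod>j<1::nat. ((real i + 1) * w - real i * w) / \<beta>)
      \<le> label_prob E \<beta> u m e (Single_Cross i)"
  proof (rule label_prob_ge[OF \<beta> u e])
    fix j :: nat
    show "0 \<le> real i * w \<and> real i * w \<le> (real i + 1) * w \<and> (real i + 1) * w \<le> \<beta>"
      using w top by (simp add: algebra_simps)
  next
    fix c b' :: point_sample
    assume c: "c \<in> arrivals 1 (\<lambda>j. {real i * w..<(real i + 1) * w})" "fst b' = 0"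
    then have "window \<beta> m (snd c 0) = i"
      using \<beta> by (intro window_eqI) (auto simp: arrivals_def w_def)
    then show "link_label \<beta> m c b' = Single_Cross i"
      using c i by (simp add: link_label_def arrivals_def)
  qed
  moreover have "(real i + 1) * w - real i * w = w" by (simp add: algebra_simps)
  moreover have "w / \<beta> = 1 / (real m + 1)" using \<beta> by (simp add: w_def)
  ultimately show ?thesis by (simp add: label_bound_def)
qed

text \<open>
  The first cross in the left half of window \<open>i\<close> and the second one in the right half suffice.
\<close>

lemma label_prob_Cross_Pair:
  assumes \<beta>: "0 < \<beta>" and u: "0 \<le> u" "u \<le> 1" and e: "e \<in> E" and i: "1 \<le> i" "i \<le> m"
  shows "label_bound u m \<beta> \<le> label_prob E \<beta> u m e (Cross_Pair i)"
proof -
  define w where "w = \<beta> / (real m + 1)"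
  \<comment> \<open>\<open>a 0\<close>, \<open>a 1\<close> and \<open>a 2\<close> are the left end, the midpoint and the right end of window \<open>i\<close>.\<close>
  define a where "a j = (real i + real j / 2) * w" for j :: nat
  have w: "0 < w" using \<beta> by (simp add: w_def)
  have top: "(real i + 1) * w \<le> \<beta>"
    using mult_right_mono[of "real i + 1" "real m + 1" w] i w by (simp add: w_def)
  have two: "{..<2::nat} = {0, 1}" by auto
  have "exp (- \<beta>) * ((u * \<beta>) ^ 2 / fact 2) * (\<Prod>j<2. (a (Suc j) - a j) / \<beta>)
      \<le> label_prob E \<beta> u m e (Cross_Pair i)"
  proof (rule label_prob_ge[OF \<beta> u e])
    fix j :: nat assume "j < 2"
    then have "j = 0 \<or> j = 1" by auto
    then show "0 \<le> a j \<and> a j \<le> a (Suc j) \<and> a (Suc j) \<le> \<beta>"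
      using w top by (auto simp: a_def algebra_simps)
  next
    fix c b' :: point_sample
    assume c: "c \<in> arrivals 2 (\<lambda>j. {a j..<a (Suc j)})" "fst b' = 0"
    then have t: "a 0 \<le> snd c 0" "snd c 0 < a 1" "a 1 \<le> snd c 1" "snd c 1 < a 2"
      by (auto simp: arrivals_def numeral_2_eq_2)
    have "a 0 = real i * w" "a 0 \<le> a 1" "a 1 \<le> a 2" "a 2 = (real i + 1) * w"
      using w by (simp_all add: a_def algebra_simps)
    then have "window \<beta> m (snd c 0) = i" "window \<beta> m (snd c 1) = i"
      using \<beta> t by (auto intro!: window_eqI simp: w_def)
    moreover have "snd c 0 < snd c 1" using t by linarith
    ultimately show "link_label \<beta> m c b' = Cross_Pair i"
      using c i by (simp add: link_label_def arrivals_def)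
  qed
  moreover have "(a (Suc j) - a j) / \<beta> = 1 / (2 * (real m + 1))" for j
  proof -
    have "a (Suc j) - a j = w / 2" by (simp add: a_def algebra_simps add_divide_distrib)
    then show ?thesis using \<beta> by (simp add: w_def)
  qed
  moreover have "2 * ((2 * real m + 2) * (2 * real m + 2)) = 8 * ((real m + 1) * (real m + 1))"
    by (simp add: algebra_simps)
  ultimately show ?thesis by (simp add: label_bound_def two power2_eq_square min.coboundedI1)
qed

section \<open>The strict inequality\<close>

context bounded_degree_graph
begin

text \<open>
  Each of the two endpoints of \<open>e\<close> lies on at most \<open>\<Delta>\<close> edges.
\<close>

lemma card_meets:
  assumes "e \<in> E" and "F \<subseteq> E"
  shows "card {f \<in> F. meets e f} \<le> 2 * \<Delta>"
proof -
  obtain x y where e: "e = {x, y}" "x \<in> V" "y \<in> V"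
    using assms simple by (auto simp: simple_graph_def)
  have inc: "finite {f \<in> E. z \<in> f}" "card {f \<in> E. z \<in> f} \<le> \<Delta>" if "z \<in> V" for z
    using degree that by (auto simp: degree_bounded_by_def)
  have "card {f \<in> F. meets e f} \<le> card ({f \<in> E. x \<in> f} \<union> {f \<in> E. y \<in> f})"
    using assms e inc by (intro card_mono) (auto simp: meets_def)
  also have "\<dots> \<le> card {f \<in> E. x \<in> f} + card {f \<in> E. y \<in> f}" by (rule card_Un_le)
  finally show ?thesis using inc(2)[OF e(2)] inc(2)[OF e(3)] by linarith
qed

lemma meets_near_edge:
  assumes "e \<in> near_edges E v n" and "f \<in> E" and "meets e f"
  shows "f \<in> near_edges E v (Suc n)"
proof -
  obtain x where x: "x \<in> e" "x \<in> graph_ball E v n" and e: "e \<in> E"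
    using assms(1) by (auto simp: near_edges_def)
  obtain z where z: "z \<in> e" "z \<in> f" using assms(3) by (auto simp: meets_def)
  have "z \<in> graph_ball E v (Suc n)"
  proof (cases "z = x")
    case True
    then show ?thesis using x graph_ball_mono[of n "Suc n" E v] by auto
  next
    case False
    then have "e = {x, z}" using simple e x z by (auto simp: simple_graph_def)
    then show ?thesis using graph_ball_Suc[OF x(2)] e by simp
  qed
  then show ?thesis using z assms(2) by (auto simp: near_edges_def)
qed

text \<open>
  The parameter of the percolation process that dominates the effective edges. Edges have at most
  \<open>2 * \<Delta>\<close> neighbours, so \<open>2 * \<Delta> + 1\<close> windows are used in addition to window \<open>0\<close>.
\<close>

definition comparison_density :: "real \<Rightarrow> real \<Rightarrow> real" where
  "comparison_density u \<beta> = (1 - exp (- \<beta>)) *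
    (let C = block_cost (2 * \<Delta>) (label_bound u (2 * \<Delta> + 1) \<beta>) in C / (1 + C))"

lemma comparison_density_bounds:
  assumes "0 < u" and "0 < \<beta>"
  shows "comparison_density u \<beta> < 1 - exp (- \<beta>)" and "comparison_density u \<beta> \<in> {0..1}"
proof -
  define C where "C = block_cost (2 * \<Delta>) (label_bound u (2 * \<Delta> + 1) \<beta>)"
  have C: "0 \<le> C" unfolding C_def using assms by (intro block_cost_nonneg label_bound_pos)
  have p: "0 < 1 - exp (- \<beta>)" using assms by simp
  have eq: "comparison_density u \<beta> = (1 - exp (- \<beta>)) * (C / (1 + C))"
    unfolding comparison_density_def C_def Let_def ..
  have "(1 - exp (- \<beta>)) * (C / (1 + C)) < (1 - exp (- \<beta>)) * 1"
    using C p by (intro mult_strict_left_mono) auto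
  then show less: "comparison_density u \<beta> < 1 - exp (- \<beta>)" unfolding eq by simp
  have "0 \<le> comparison_density u \<beta>" unfolding eq using C p by (intro mult_nonneg_nonneg) auto
  moreover have "comparison_density u \<beta> \<le> 1" using less exp_gt_zero[of "- \<beta>"] by linarith
  ultimately show "comparison_density u \<beta> \<in> {0..1}" by simp
qed

lemma effective_escape:
  assumes u: "0 < u" "u \<le> 1" and \<beta>: "0 < \<beta>"
  defines "N \<equiv> loop_measure E \<beta> u" and "p \<equiv> comparison_density u \<beta>" and "m \<equiv> 2 * \<Delta> + 1"
  shows "{X \<in> space N. escapes E v n (effective meets E (edge_label \<beta> m X))} \<in> sets N"
    and "emeasure N {X \<in> space N. escapes E v n (effective meets E (edge_label \<beta> m X))} \<le>
      emeasure (percolation_measure E p)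
        {\<eta> \<in> space (percolation_measure E p). escapes E v n {e \<in> E. \<eta> e}}"
proof -
  \<comment> \<open>The labels on \<open>F\<close> determine which edges touching the ball of radius \<open>n\<close> are effective.\<close>
  define F where "F = near_edges E v (Suc n)"
  define q where "q = label_prob E \<beta> u m"
  let ?Q = "\<lambda>x. escapes E v n (effective meets F x)"
  have F: "finite F" "F \<subseteq> E" "near_edges E v n \<subseteq> F"
    using finite_near_edges near_edges_subset graph_ball_mono[of n "Suc n" E v]
    by (auto simp: F_def near_edges_def)
  have eq: "escapes E v n (effective meets E (edge_label \<beta> m X)) \<longleftrightarrow>
      ?Q (\<lambda>e\<in>F. edge_label \<beta> m X e)" for X
  proof (rule escapes_cong)
    have "e \<in> effective meets E (edge_label \<beta> m X) \<longleftrightarrow>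
        e \<in> effective meets F (restrict (edge_label \<beta> m X) F)" if "e \<in> near_edges E v n" for e
      using F that meets_near_edge[OF that] by (intro effective_local) (auto simp: F_def)
    then show "effective meets E (edge_label \<beta> m X) \<inter> near_edges E v n =
        effective meets F (\<lambda>e\<in>F. edge_label \<beta> m X e) \<inter> near_edges E v n" by auto
  qed
  have q0: "0 \<le> q e l" for e l by (simp add: q_def label_prob_def)
  note law = emeasure_finite_labels[where N = N and F = F and L = "labels m"
      and f = "\<lambda>e X. edge_label \<beta> m X e" and q = q and Q = ?Q]
  note elaw = edge_labels_law[OF \<beta> F(1,2), where u = u and m = m, folded N_def q_def]
  show "{X \<in> space N. escapes E v n (effective meets E (edge_label \<beta> m X))} \<in> sets N"
    unfolding eq by (intro law F(1) finite_labels edge_label_mem elaw q0)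
  have "emeasure N {X \<in> space N. escapes E v n (effective meets E (edge_label \<beta> m X))} =
      ennreal (\<Sum>x\<in>F \<rightarrow>\<^sub>E labels m. (\<Prod>e\<in>F. q e (x e)) * of_bool (?Q x))"
    unfolding eq by (intro law F(1) finite_labels edge_label_mem elaw q0)
  also have "\<dots> \<le> ennreal (bernoulli_sum p F (\<lambda>T. of_bool (escapes E v n T)))"
  proof (intro ennreal_leI)
    have "(\<Sum>x\<in>F \<rightarrow>\<^sub>E labels (2 * \<Delta> + 1). (\<Prod>e\<in>F. q e (x e)) *
        (of_bool (escapes E v n (effective meets F x)) :: real)) \<le>
      bernoulli_sum ((1 - exp (- \<beta>)) *
        (block_cost (2 * \<Delta>) (label_bound u m \<beta>) / (1 + block_cost (2 * \<Delta>) (label_bound u m \<beta>))))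
        F (\<lambda>T. of_bool (escapes E v n T))"
    proof (rule effective_domination[OF F(1)])
      show "meets g f" if "meets f g" for f g :: "'a set" using that by (auto simp: meets_def)
      show "\<not> meets f f" for f :: "'a set" by (simp add: meets_def)
      show "card {g \<in> F. meets f g} \<le> 2 * \<Delta>" if "f \<in> F" for f
        using that F(2) by (intro card_meets) auto
      show "0 \<le> q g l" for g l by (rule q0)
      show "sum (q g) (labels (2 * \<Delta> + 1)) = 1" if "g \<in> F" for g
        using that F(2) sum_label_prob[OF \<beta>, of g E u m] by (auto simp: q_def m_def)
      show "q g Vacant = 1 - (1 - exp (- \<beta>))" if "g \<in> F" for g
        using that F(2) u label_prob_Vacant[OF \<beta>, of u g E m] by (auto simp: q_def)
      show "0 < label_bound u m \<beta>" using u \<beta> by (intro label_bound_pos)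
      show "label_bound u m \<beta> \<le> q g (Cross_Pair i)" if "g \<in> F" "i \<in> {1..2 * \<Delta> + 1}" for g i
        unfolding q_def using that F(2) u by (intro label_prob_Cross_Pair \<beta>) (auto simp: m_def)
      show "label_bound u m \<beta> \<le> q g (Single_Cross i)" if "g \<in> F" "i \<in> {0..2 * \<Delta> + 1}" for g i
        unfolding q_def using that F(2) u by (intro label_prob_Single_Cross \<beta>) (auto simp: m_def)
      show "of_bool (escapes E v n T) \<le> (of_bool (escapes E v n T') :: real)"
        if "T \<subseteq> T'" "T' \<subseteq> F" for T T'
        using that escapes_mono[of E v n T T'] by auto
    qed
    then show "(\<Sum>x\<in>F \<rightarrow>\<^sub>E labels m. (\<Prod>e\<in>F. q e (x e)) * of_bool (?Q x)) \<le>
        bernoulli_sum p F (\<lambda>T. of_bool (escapes E v n T))"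
      by (simp add: p_def comparison_density_def Let_def m_def)
  qed
  also have "\<dots> = emeasure (percolation_measure E p)
      {\<eta> \<in> space (percolation_measure E p). escapes E v n {e \<in> E. \<eta> e}}"
    unfolding p_def
    by (intro percolation_escape(2)[symmetric] F comparison_density_bounds(2) u(1) \<beta>)
  finally show "emeasure N {X \<in> space N. escapes E v n (effective meets E (edge_label \<beta> m X))} \<le>
      emeasure (percolation_measure E p)
        {\<eta> \<in> space (percolation_measure E p). escapes E v n {e \<in> E. \<eta> e}}" .
qed

text \<open>
  The outer measure is bounded by the probabilities of the measurable events that the effective
  cluster of \<open>v\<close> escapes from a ball.
\<close>

lemma no_infinite_loops:
  assumes u: "0 < u" "u \<le> 1" and \<beta>: "0 < \<beta>" and sub: "comparison_density u \<beta> < p_c E v"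
  shows "outer_measure_of (loop_measure E \<beta> u)
    {X \<in> space (loop_measure E \<beta> u). infinite (loop_vertices V E \<beta> X v)} = 0"
proof -
  let ?N = "loop_measure E \<beta> u" and ?m = "2 * \<Delta> + 1" and ?p = "comparison_density u \<beta>"
  let ?I = "{X \<in> space ?N. infinite (loop_vertices V E \<beta> X v)}"
  let ?A = "\<lambda>n. {X \<in> space ?N. escapes E v n (effective meets E (edge_label \<beta> ?m X))}"
  let ?P = "\<lambda>n. emeasure (percolation_measure E ?p)
        {\<eta> \<in> space (percolation_measure E ?p). escapes E v n {e \<in> E. \<eta> e}}"
  have "outer_measure_of ?N ?I \<le> ?P n" for n
  proof -
    have "?I \<subseteq> ?A n"
    proof
      fix X assume X: "X \<in> ?I"
      let ?T = "effective meets E (edge_label \<beta> ?m X)"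
      have "infinite (component ?T v)"
        using X loop_vertices_subset_effective[OF \<beta>, of V E X v ?m] finite_subset by auto
      moreover have "?T \<subseteq> E" by (auto simp: effective_def occupied_def)
      ultimately show "X \<in> ?A n" using X infinite_component_iff by auto
    qed
    then have "outer_measure_of ?N ?I \<le> outer_measure_of ?N (?A n)" by (rule outer_measure_of_mono)
    also have "\<dots> = emeasure ?N (?A n)" by (intro outer_measure_of_eq effective_escape u \<beta>)
    also have "\<dots> \<le> ?P n" by (intro effective_escape u \<beta>)
    finally show ?thesis .
  qed
  then have "outer_measure_of ?N ?I \<le> (INF n. ?P n)" by (intro INF_greatest)
  also have "\<dots> = 0"
    by (intro subcritical sub comparison_density_bounds(2) u(1) \<beta>)
  finally show ?thesis by simp
qed

end

theorem theorem2p1: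
  fixes V :: "'a set" and E :: "'a set set" and \<Delta> :: nat and u :: real and v :: 'a
  assumes "simple_graph V E"
    and "countable V" and "infinite V"
    and "connected_graph V E"
    and "degree_bounded_by V E \<Delta>"
    and "v \<in> V"
    and "p_c E v < 1"
    and "0 < u" and "u \<le> 1"
  shows "beta_c V E u v > ereal (beta_c_per E v)"
proof -
  interpret bounded_degree_graph V E \<Delta> v using assms by unfold_locales
  define b where "b = beta_c_per E v"
  let ?f = "comparison_density u"
  have b0: "0 < b" and pb: "1 - exp (- b) = p_c E v"
    using p_c_pos assms(7) by (simp_all add: b_def beta_c_per_def)
  have "isCont ?f b"
  proof -
    have "label_bound u (2 * \<Delta> + 1) b \<noteq> 0" using label_bound_pos[OF assms(8) b0] by (metis less_irrefl)
    moreover have "1 + block_cost (2 * \<Delta>) (label_bound u (2 * \<Delta> + 1) b) \<noteq> 0"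
      using block_cost_nonneg[OF label_bound_pos[OF assms(8) b0]] by (smt (verit))
    moreover have "isCont (label_bound u (2 * \<Delta> + 1)) b"
      unfolding label_bound_def by (intro continuous_intros) auto
    ultimately show ?thesis
      unfolding comparison_density_def[abs_def] block_cost_def Let_def
      by (intro continuous_intros) auto
  qed
  then have "(?f \<longlongrightarrow> ?f b) (at b)" by (simp add: isCont_def)
  moreover have "?f b < p_c E v" using comparison_density_bounds(1)[OF assms(8) b0] pb by simp
  ultimately have "\<forall>\<^sub>F \<beta> in at b. ?f \<beta> < p_c E v" by (rule order_tendstoD(2))
  then obtain \<delta> where \<delta>: "0 < \<delta>" "\<And>\<beta>. \<beta> \<noteq> b \<Longrightarrow> dist \<beta> b < \<delta> \<Longrightarrow> ?f \<beta> < p_c E v"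
    by (auto simp: eventually_at)
  \<comment> \<open>Up to \<open>b\<close> the trivial bound by \<open>1 - exp (- \<beta>)\<close> suffices; beyond it continuity at \<open>b\<close> is used.\<close>
  have sub: "?f \<beta> < p_c E v" if "0 < \<beta>" "\<beta> < b + \<delta>" for \<beta>
  proof (cases "\<beta> \<le> b")
    case True
    then have "1 - exp (- \<beta>) \<le> 1 - exp (- b)" by simp
    then show ?thesis using comparison_density_bounds(1)[OF assms(8) that(1)] pb by linarith
  next
    case False
    then show ?thesis using \<delta>(2)[of \<beta>] that by (auto simp: dist_real_def)
  qed
  have "ereal (b + \<delta>) \<le> beta_c V E u v"
    unfolding beta_c_def
  proof (rule Inf_greatest)
    fix z assume "z \<in> ereal ` {\<beta>. \<beta> > 0 \<and> outer_measure_of (loop_measure E \<beta> u)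
       {X \<in> space (loop_measure E \<beta> u). infinite (loop_vertices V E \<beta> X v)} > 0}"
    then obtain \<beta> where \<beta>: "z = ereal \<beta>" "0 < \<beta>"
      "outer_measure_of (loop_measure E \<beta> u)
       {X \<in> space (loop_measure E \<beta> u). infinite (loop_vertices V E \<beta> X v)} > 0" by auto
    have "\<not> \<beta> < b + \<delta>"
      using no_infinite_loops[OF assms(8,9) \<beta>(2) sub[OF \<beta>(2)]] \<beta>(3) by auto
    then show "ereal (b + \<delta>) \<le> z" using \<beta>(1) by simp
  qed
  moreover have "ereal b < ereal (b + \<delta>)" using \<delta>(1) by simp
  ultimately show ?thesis unfolding b_def by (rule less_le_trans[rotated])
qed

end
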